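(* Let $d\ge 2$, let $\Delta$ be a $G_\delta$-subset of the projective space $P(\mathbb R^d)$ and let $D$ be a countable subset of $\Delta$. Then there is a rank-one free infinite measure preserving action $T$ of $\mathbb Z^d$ such that $D\subset\mathcal R(T)\subset\Delta$. In particular, each countable $G_\delta$-subset (e.g. each countable compact subset) of $P(\mathbb R^d)$ is realizable as $\mathcal R(T)$ for some rank-one free action $T$ of $\mathbb Z^d$.
   Context: $P(\mathbb R^d)$ is the set of lines (1-dimensional linear subspaces) in $\mathbb R^d$ with the usual topology of projective space; $\mathrm{dist}$ is the Euclidean distance on $\mathbb R^d$. Actions are measure preserving actions $T=(T_\gamma)_{\gamma\in\mathbb Z^d}$ on $\sigma$-finite standard measure spaces $(X,\mathfrak B,\mu)$; $T$ is infinite measure preserving if $\mu(X)=\infty$, and free if for each $\gamma\neq 0$, $T_\gamma x\ne x$ for a.e. $x$. $T$ is recurrent along a line $\theta\in P(\mathbb R^d)$ if for each $\epsilon>0$ and each $A\in\mathfrak B$ with $\mu(A)>0$ there are $\gamma\in\mathbb Z^d\setminus\{0\}$ and $g\in\theta$ such that $\mathrm{dist}(\gamma,g)<\epsilon$ and $\mu(A\cap T_\gamma A)>0$. $\mathcal R(T)$ is the set of all $\theta\in P(\mathbb R^d)$ such that $T$ is recurrent along $\theta$. Rank one (by cubes): there are a sequence of cubes $F_n=\{(i_1,\dots,i_d)\in\mathbb Z^d: -a_n<i_j\le a_n,\ j=1,\dots,d\}$ with integers $a_n\to\infty$ and measurable sets $B_n\subset X$ with $0<\mu(B_n)<\infty$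 such that for each $n$ the sets $T_\gamma B_n$, $\gamma\in F_n$, are pairwise disjoint, and for every measurable $A\subset X$ with $\mu(A)<\infty$, $\lim_{n\to\infty}\min_{F\subset F_n}\mu\big(A\,\triangle\,\bigsqcup_{\gamma\in F}T_\gamma B_n\big)=0$. *)

theory Defs
  imports "HOL-Analysis.Analysis"
begin

section \<open>The projective space\<close>

definition projective_space :: "(real ^ 'd) set set"
  where "projective_space = {\<theta>. subspace \<theta> \<and> dim \<theta> = 1}"

text \<open>
  The quotient topology along \<open>x \<mapsto> \<real> x\<close> from the nonzero vectors; see \<open>quotient_map_projective\<close>
  below.
\<close>

definition projective_topology :: "(real ^ 'd) set topology"
  where "projective_topology =
    topology (\<lambda>U. U \<subseteq> projective_space \<and> open {x. x \<noteq> 0 \<and> span {x} \<in> U})"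

lemma openin_projective_topology:
  "openin projective_topology U \<longleftrightarrow>
     U \<subseteq> projective_space \<and> open {x::real ^ 'd. x \<noteq> 0 \<and> span {x} \<in> U}"
proof -
  let ?P = "\<lambda>U. U \<subseteq> projective_space \<and> open {x::real ^ 'd. x \<noteq> 0 \<and> span {x} \<in> U}"
  have "istopology ?P"
    unfolding istopology_def
  proof (intro conjI allI impI)
    fix S T assume S: "?P S" and T: "?P T"
    show "S \<inter> T \<subseteq> projective_space"
      using S by blast
    have "{x::real ^ 'd. x \<noteq> 0 \<and> span {x} \<in> S \<inter> T} =
        {x. x \<noteq> 0 \<and> span {x} \<in> S} \<inter> {x. x \<noteq> 0 \<and> span {x} \<in> T}"
      by blast
    then show "open {x::real ^ 'd. x \<noteq> 0 \<and> span {x} \<in> S \<inter> T}"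
      using S T by (simp only: open_Int)
  next
    fix K assume K: "\<forall>S\<in>K. ?P S"
    then show "\<Union>K \<subseteq> projective_space"
      by blast
    have "{x::real ^ 'd. x \<noteq> 0 \<and> span {x} \<in> \<Union>K} = (\<Union>S\<in>K. {x. x \<noteq> 0 \<and> span {x} \<in> S})"
      by blast
    then show "open {x::real ^ 'd. x \<noteq> 0 \<and> span {x} \<in> \<Union>K}"
      using K by (metis (no_types, lifting) open_UN)
  qed
  then show ?thesis
    unfolding projective_topology_def by simp
qed

lemma span_singleton_in_projective_space:
  "x \<noteq> 0 \<Longrightarrow> span {x} \<in> projective_space"
  by (simp add: projective_space_def dim_singleton)

lemma topspace_projective_topology:
  "topspace projective_topology = (projective_space :: (real ^ 'd) set set)"
proof -
  have "{x::real ^ 'd. x \<noteq> 0 \<and> span {x} \<in> projective_space} = - {0}"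
    using span_singleton_in_projective_space by auto
  moreover have "open (- {0 :: real ^ 'd})"
    by (simp add: open_Compl)
  ultimately have "openin projective_topology (projective_space :: (real ^ 'd) set set)"
    by (simp only: openin_projective_topology subset_refl simp_thms)
  moreover have "topspace projective_topology \<subseteq> (projective_space :: (real ^ 'd) set set)"
    using openin_projective_topology openin_topspace by blast
  ultimately show ?thesis
    by (simp add: openin_subset subset_antisym)
qed

lemma quotient_map_projective:
  "quotient_map (top_of_set (- {0 :: real ^ 'd})) projective_topology (\<lambda>x. span {x})"
proof -
  have "(\<lambda>x. span {x}) ` (- {0 :: real ^ 'd}) = projective_space"
  proof (intro equalityI subsetI)
    fix \<theta> :: "(real ^ 'd) set" assume "\<theta> \<in> projective_space"
    then have \<theta>: "subspace \<theta>" "dim \<theta> = 1"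
      by (auto simp: projective_space_def)
    obtain B where B: "B \<subseteq> \<theta>" "independent B" "\<theta> \<subseteq> span B" "card B = dim \<theta>"
      using basis_exists by blast
    then obtain x where x: "B = {x}"
      using \<theta> by (metis card_1_singletonE)
    then have "x \<noteq> 0" "\<theta> = span {x}"
      using B \<theta> by (auto simp: span_minimal subset_antisym)
    then show "\<theta> \<in> (\<lambda>x. span {x}) ` (- {0})"
      by auto
  qed (use span_singleton_in_projective_space in blast)
  moreover have "openin (top_of_set (- {0 :: real ^ 'd})) {x. x \<noteq> 0 \<and> span {x} \<in> U} \<longleftrightarrow>
      open {x :: real ^ 'd. x \<noteq> 0 \<and> span {x} \<in> U}" for U
    by (subst openin_open_eq) auto
  ultimately show ?thesis
    by (auto simp: quotient_map_def topspace_projective_topology openin_projective_topology)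
qed


section \<open>Actions of the integer lattice\<close>

definition standard_borel :: "'a measure \<Rightarrow> bool"
  where "standard_borel M \<longleftrightarrow>
    (\<exists>X. completely_metrizable_space X \<and> separable_space X \<and> topspace X = space M \<and>
         sets M = sigma_sets (topspace X) {U. openin X U})"

text \<open>
  As the acting group is countable, requiring the action identities everywhere rather than almost
  everywhere is no restriction.
\<close>

locale lattice_action = sigma_finite_measure M
  for M :: "'a measure" +
  fixes T :: "int ^ 'd \<Rightarrow> 'a \<Rightarrow> 'a"
  assumes standard: "standard_borel M"
    and action_zero: "x \<in> space M \<Longrightarrow> T 0 x = x"
    and action_add: "x \<in> space M \<Longrightarrow> T (\<gamma> + \<delta>) x = T \<gamma> (T \<delta> x)"
    and action_measurable: "T \<gamma> \<in> measurable M M"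
    and action_preserving: "A \<in> sets M \<Longrightarrow> emeasure M (T \<gamma> -` A \<inter> space M) = emeasure M A"

definition free_action :: "'a measure \<Rightarrow> (int ^ 'd \<Rightarrow> 'a \<Rightarrow> 'a) \<Rightarrow> bool"
  where "free_action M T \<longleftrightarrow> (\<forall>\<gamma>. \<gamma> \<noteq> 0 \<longrightarrow> (AE x in M. T \<gamma> x \<noteq> x))"

definition real_vec :: "int ^ 'd \<Rightarrow> real ^ 'd"
  where "real_vec \<gamma> = (\<chi> j. real_of_int (\<gamma> $ j))"

definition recurrent_along :: "'a measure \<Rightarrow> (int ^ 'd \<Rightarrow> 'a \<Rightarrow> 'a) \<Rightarrow> (real ^ 'd) set \<Rightarrow> bool"
  where "recurrent_along M T \<theta> \<longleftrightarrow>
    (\<forall>\<epsilon>>0. \<forall>A\<in>sets M. emeasure M A > 0 \<longrightarrow>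
       (\<exists>\<gamma>. \<gamma> \<noteq> 0 \<and> (\<exists>g\<in>\<theta>. dist (real_vec \<gamma>) g < \<epsilon>) \<and> emeasure M (A \<inter> T \<gamma> ` A) > 0))"

definition recurrence_lines :: "'a measure \<Rightarrow> (int ^ 'd \<Rightarrow> 'a \<Rightarrow> 'a) \<Rightarrow> (real ^ 'd) set set"
  where "recurrence_lines M T = {\<theta> \<in> projective_space. recurrent_along M T \<theta>}"

definition cube :: "int \<Rightarrow> (int ^ 'd) set"
  where "cube a = {\<gamma>. \<forall>j. - a < \<gamma> $ j \<and> \<gamma> $ j \<le> a}"

lemma finite_cube: "finite (cube a :: (int ^ 'd) set)"
proof (rule finite_imageD)
  have "vec_nth ` (cube a :: (int ^ 'd) set) \<subseteq> UNIV \<rightarrow>\<^sub>E {- a<..a}"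
    by (auto simp: cube_def)
  then show "finite (vec_nth ` (cube a :: (int ^ 'd) set))"
    by (rule finite_subset) (simp add: finite_PiE)
  show "inj_on vec_nth (cube a :: (int ^ 'd) set)"
    by (simp add: inj_on_def vec_nth_inject)
qed

definition rank_one :: "'a measure \<Rightarrow> (int ^ 'd \<Rightarrow> 'a \<Rightarrow> 'a) \<Rightarrow> bool"
  where "rank_one M T \<longleftrightarrow>
    (\<exists>(a :: nat \<Rightarrow> int) (B :: nat \<Rightarrow> 'a set).
       filterlim a at_top sequentially \<and>
       (\<forall>n. B n \<in> sets M \<and> 0 < emeasure M (B n) \<and> emeasure M (B n) < \<infinity> \<and>
            disjoint_family_on (\<lambda>\<gamma>. T \<gamma> ` B n) (cube (a n))) \<and>
       (\<forall>A\<in>sets M. emeasure M A < \<infinity> \<longrightarrow>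
          (\<lambda>n. MIN F\<in>Pow (cube (a n)). emeasure M (sym_diff A (\<Union>\<gamma>\<in>F. T \<gamma> ` B n)))
            \<longlonglongrightarrow> 0))"

end

theory Submission
  imports Defs
begin

text \<open>
  A dyadic cutting-and-stacking construction on the half-line: the levels of the \<open>n\<close>-th tower are
  indexed by the cube of side \<open>2 a\<^sub>n\<close>, and each level is halved, the two halves being a translation
  \<open>c\<^sub>n\<close> apart in the next tower. The return times to a level of the \<open>m\<close>-th tower are the sums of
  \<open>\<plusminus> c\<^sub>k\<close> over finite sets of \<open>k \<ge> m\<close>. A positive measure set fills more than half of some level of
  each late tower, hence meets its translates by the late \<open>c\<^sub>n\<close>; so \<open>T\<close> is recurrent along every
  line approached by infinitely many \<open>c\<^sub>n\<close>, and it is not recurrent along a line from which \<open>c\<^sub>n\<close> is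
  eventually further away than the bound \<open>a\<^sub>n\<close> on the sum of the previous translations. Writing
  \<open>\<Delta>\<close> as a decreasing intersection of open sets \<open>U\<^sub>n\<close>, the vector \<open>c\<^sub>n\<close> is chosen extremely close
  to the \<open>n\<close>-th term of a sequence running infinitely often through \<open>D\<close>, and so long that it is far
  from all lines outside \<open>U\<^sub>n\<close>.
\<close>

section \<open>Cubes in the lattice\<close>

lemma card_cube: "card (cube b :: (int ^ 'd) set) = nat (2 * b) ^ CARD('d)"
proof -
  have "bij_betw vec_nth (cube b :: (int ^ 'd) set) (UNIV \<rightarrow>\<^sub>E {- b<..b})"
  proof (rule bij_betw_byWitness[where f' = vec_lambda])
    show "vec_nth ` (cube b :: (int ^ 'd) set) \<subseteq> UNIV \<rightarrow>\<^sub>E {- b<..b}"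
      by (auto simp: cube_def)
    show "vec_lambda ` (UNIV \<rightarrow>\<^sub>E {- b<..b}) \<subseteq> (cube b :: (int ^ 'd) set)"
      by (force simp: cube_def PiE_iff)
  qed auto
  then have "card (cube b :: (int ^ 'd) set) = card ((UNIV :: 'd set) \<rightarrow>\<^sub>E {- b<..b})"
    by (rule bij_betw_same_card)
  then show ?thesis
    by (simp add: card_PiE)
qed

lemma real_vec_add: "real_vec (\<gamma> + \<delta>) = real_vec \<gamma> + real_vec \<delta>"
  and real_vec_minus: "real_vec (- \<gamma>) = - real_vec \<gamma>"
  and real_vec_zero: "real_vec 0 = 0"
  by (simp_all add: real_vec_def vec_eq_iff)

lemma norm_real_vec_le: "norm (real_vec \<gamma>) \<le> real_of_int (\<Sum>j\<in>UNIV. \<bar>\<gamma> $ j\<bar>)"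
  using norm_le_l1_cart[of "real_vec \<gamma>"] by (simp add: real_vec_def)

section \<open>Dyadic cutting and stacking\<close>

definition dyadic :: "nat \<Rightarrow> nat \<Rightarrow> real set"
  where "dyadic n i = {real i / 2 ^ n..<(real i + 1) / 2 ^ n}"

definition dyadic_index :: "nat \<Rightarrow> real \<Rightarrow> nat"
  where "dyadic_index n x = nat \<lfloor>2 ^ n * x\<rfloor>"

lemma mem_dyadic_iff: "x \<in> dyadic n i \<longleftrightarrow> real i \<le> 2 ^ n * x \<and> 2 ^ n * x < real i + 1"
  by (auto simp: dyadic_def field_simps)

text \<open>Turns membership into an equation for the index, which makes disjointness of distinct
  intervals of one generation immediate.\<close>

lemma mem_dyadic: "x \<in> dyadic n i \<longleftrightarrow> 0 \<le> x \<and> dyadic_index n x = i"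
proof -
  have "x \<in> dyadic n i \<longleftrightarrow> real i \<le> 2 ^ n * x \<and> 2 ^ n * x < real i + 1"
    by (rule mem_dyadic_iff)
  also have "\<dots> \<longleftrightarrow> \<lfloor>2 ^ n * x\<rfloor> = int i"
    by (simp add: floor_eq_iff)
  also have "\<dots> \<longleftrightarrow> 0 \<le> x \<and> dyadic_index n x = i"
  proof -
    have "0 \<le> \<lfloor>2 ^ n * x\<rfloor> \<longleftrightarrow> 0 \<le> x"
      by (simp add: zero_le_mult_iff) (smt (verit) zero_less_power)
    then show ?thesis
      unfolding dyadic_index_def by linarith
  qed
  finally show ?thesis .
qed

lemma dyadic_index_bounds:
  assumes "0 \<le> x"
  shows "real (dyadic_index n x) \<le> 2 ^ n * x" "2 ^ n * x < real (dyadic_index n x) + 1"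
  using assms mem_dyadic[of x n "dyadic_index n x"] by (auto simp: mem_dyadic_iff)

text \<open>The relative position \<open>2 ^ n * x - real (dyadic_index n x)\<close> lies in
  \<open>[0, 1)\<close>, and comparing it with \<open>1 / 2\<close> tells which half of the interval
  contains \<open>x\<close>.\<close>

lemma dyadic_index_Suc:
  assumes "0 \<le> x"
  shows "dyadic_index (Suc n) x =
    2 * dyadic_index n x + (if 2 ^ n * x - real (dyadic_index n x) < 1 / 2 then 0 else 1)"
proof -
  let ?i = "2 * dyadic_index n x + (if 2 ^ n * x - real (dyadic_index n x) < 1 / 2 then 0 else 1)"
  have "x \<in> dyadic (Suc n) ?i"
    using dyadic_index_bounds[OF assms, of n] by (auto simp: mem_dyadic_iff)
  then show ?thesis
    by (simp add: mem_dyadic)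
qed

lemma dyadic_borel [measurable]: "dyadic n i \<in> sets borel"
  by (simp add: dyadic_def)

lemma emeasure_dyadic: "emeasure lborel (dyadic n i) = ennreal (1 / 2 ^ n)"
proof -
  have "(real i + 1) / 2 ^ n - real i / 2 ^ n = 1 / 2 ^ n"
    by (simp add: field_simps)
  then show ?thesis
    by (simp add: dyadic_def divide_right_mono)
qed

lemma dyadic_halves:
  "dyadic (Suc n) (2 * i) \<union> dyadic (Suc n) (2 * i + 1) = dyadic n i"
proof -
  have "2 * k + (if P then 0 else 1) = 2 * i \<or> 2 * k + (if P then 0 else 1) = 2 * i + 1 \<longleftrightarrow> k = i"
    for k :: nat and P
    by (auto; presburger)
  then show ?thesis
    by (auto simp: mem_dyadic dyadic_index_Suc split: if_splits)
qed

text \<open>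
  At stage \<open>n\<close> the interval \<open>dyadic n i\<close> is the level labelled \<open>p n i\<close> of a tower of shape
  \<open>cube (a n)\<close>; its left and right halves become the levels labelled \<open>p n i\<close> and \<open>p n i + c n\<close>
  of the next tower, whose remaining levels are the next dyadic intervals to the right.
\<close>

locale dyadic_towers =
  fixes a :: "nat \<Rightarrow> int" and c :: "nat \<Rightarrow> int ^ 'd" and p :: "nat \<Rightarrow> nat \<Rightarrow> int ^ 'd"
  assumes dim_ge_2: "CARD('d) \<ge> 2"
    and a_0: "1 \<le> a 0"
    and a_Suc: "2 * a n + (\<Sum>j\<in>UNIV. \<bar>c n $ j\<bar>) \<le> a (Suc n)"
    and p_bij: "bij_betw (p n) {..<card (cube (a n) :: (int ^ 'd) set)} (cube (a n))"
    and p_even: "i < card (cube (a n) :: (int ^ 'd) set) \<Longrightarrow> p (Suc n) (2 * i) = p n i"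
    and p_odd: "i < card (cube (a n) :: (int ^ 'd) set) \<Longrightarrow> p (Suc n) (2 * i + 1) = p n i + c n"
begin

section \<open>Growth of the cubes and of the towers\<close>

definition height :: "nat \<Rightarrow> nat"
  where "height n = card (cube (a n) :: (int ^ 'd) set)"

lemma a_double: "2 * a n \<le> a (Suc n)"
  using a_Suc[of n] sum_nonneg[of UNIV "\<lambda>j. \<bar>c n $ j\<bar>"] abs_ge_zero by (smt (verit))

lemma a_ge_power: "2 ^ n \<le> a n"
proof (induction n)
  case (Suc n)
  then show ?case
    using a_double[of n] by (simp del: mult_le_cancel_left_pos)
qed (use a_0 in simp)

lemma a_pos: "0 < a n"
  using a_ge_power[of n] zero_less_power[of "2::int" n] by linarith

lemma filterlim_a: "filterlim a at_top sequentially"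
proof (rule filterlim_at_top_mono)
  show "filterlim (\<lambda>n. int n) at_top sequentially"
    by (rule filterlim_int_sequentially)
  show "\<forall>\<^sub>F n in sequentially. int n \<le> a n"
  proof (rule always_eventually, rule allI)
    fix n
    have "int n \<le> 2 ^ n"
      by (metis less_exp of_nat_less_iff of_nat_numeral of_nat_power order_less_imp_le)
    then show "int n \<le> a n"
      using a_ge_power[of n] by linarith
  qed
qed

lemma height_Suc: "2 * height n \<le> height (Suc n)"
proof -
  have "2 * nat (2 * a n) ^ CARD('d) \<le> 2 ^ CARD('d) * nat (2 * a n) ^ CARD('d)"
    using dim_ge_2 power_increasing[of 1 "CARD('d)" "2::nat"] by simp
  also have "\<dots> = (2 * nat (2 * a n)) ^ CARD('d)"
    by (simp only: power_mult_distrib)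
  also have "\<dots> \<le> nat (2 * a (Suc n)) ^ CARD('d)"
    using a_double[of n] by (intro power_mono) linarith+
  finally show ?thesis
    by (simp add: height_def card_cube)
qed

text \<open>The cube has side at least \<open>2 ^ n\<close> and dimension at least 2. As levels have
  length \<open>1 / 2 ^ n\<close>, the \<open>n\<close>-th tower covers \<open>[0, 2 ^ n)\<close>,
  so the towers exhaust the half-line.\<close>

lemma height_ge: "4 ^ n \<le> height n"
proof -
  have "(2::nat) ^ n \<le> nat (2 * a n)"
    using a_ge_power[of n] a_pos[of n] by (simp add: le_nat_iff)
  then have "(2 ^ n) ^ 2 \<le> nat (2 * a n) ^ 2"
    by (rule power_mono) simp
  also have "\<dots> \<le> nat (2 * a n) ^ CARD('d)"
    using dim_ge_2 a_pos[of n] by (intro power_increasing) auto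
  finally show ?thesis
    by (simp add: height_def card_cube power2_eq_square flip: power_mult_distrib)
qed

lemma height_pos: "0 < height n"
  using height_ge[of n] zero_less_power[of "4::nat" n] by linarith

lemma eventually_in_tower: "\<forall>\<^sub>F n in sequentially. dyadic_index n x < height n"
proof -
  obtain N :: nat where N: "x < real N"
    using reals_Archimedean2 by blast
  have "dyadic_index n x < height n" if "N \<le> n" for n
  proof -
    have "x < 2 ^ n"
      using N that of_nat_less_two_power[of n, where ?'a = real] of_nat_mono[OF that, where ?'a = real]
      by linarith
    then have "2 ^ n * x < 2 ^ n * 2 ^ n"
      by simp
    then have "2 ^ n * x < real (4 ^ n)"
      by (simp flip: power_mult_distrib)
    then have "dyadic_index n x < 4 ^ n"
      unfolding dyadic_index_def by (simp add: floor_less_iff nat_less_iff)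
    then show ?thesis
      using height_ge[of n] by linarith
  qed
  then show ?thesis
    by (auto simp: eventually_sequentially)
qed

lemma p_inj: "i < height n \<Longrightarrow> i' < height n \<Longrightarrow> p n i = p n i' \<Longrightarrow> i = i'"
  using p_bij[of n] unfolding bij_betw_def inj_on_def height_def by blast

lemma p_in_cube: "i < height n \<Longrightarrow> p n i \<in> cube (a n)"
  using p_bij[of n] by (auto simp: bij_betw_def height_def)

lemma p_surj:
  assumes "\<gamma> \<in> cube (a n)"
  obtains i where "i < height n" "p n i = \<gamma>"
proof -
  have "\<gamma> \<in> p n ` {..<height n}"
    using p_bij[of n] assms by (simp add: bij_betw_def height_def)
  then show ?thesis
    using that by blast
qed

section \<open>Partial translations of a single tower\<close>

definition label :: "nat \<Rightarrow> real \<Rightarrow> int ^ 'd"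
  where "label n x = p n (dyadic_index n x)"

text \<open>The partial action of \<open>\<gamma>\<close> on the \<open>n\<close>-th tower: levels
  are permuted according to their labels, and the last equation keeps the relative position inside
  the level. It is a relation because the target label may leave the cube.\<close>

definition moves :: "int ^ 'd \<Rightarrow> nat \<Rightarrow> real \<Rightarrow> real \<Rightarrow> bool"
  where "moves \<gamma> n x y \<longleftrightarrow> 0 \<le> x \<and> 0 \<le> y \<and> dyadic_index n x < height n \<and>
    dyadic_index n y < height n \<and> label n y = label n x + \<gamma> \<and>
    2 ^ n * y - real (dyadic_index n y) = 2 ^ n * x - real (dyadic_index n x)"

lemma label_Suc:
  assumes "0 \<le> x" "dyadic_index n x < height n"
  shows "label (Suc n) x =
    label n x + (if 2 ^ n * x - real (dyadic_index n x) < 1 / 2 then 0 else c n)"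
  using assms p_even[of "dyadic_index n x" n] p_odd[of "dyadic_index n x" n]
  by (simp add: label_def dyadic_index_Suc height_def)

lemma dyadic_index_less_height_Suc:
  assumes "0 \<le> x" "dyadic_index n x < height n"
  shows "dyadic_index (Suc n) x < height (Suc n)"
  using assms height_Suc[of n] by (simp add: dyadic_index_Suc)

text \<open>Equal relative positions put \<open>x\<close> and \<open>y\<close> into halves of the
  same side, so both labels gain the same increment, \<open>0\<close> or \<open>c n\<close>, and
  their difference stays \<open>\<gamma>\<close>.\<close>

lemma moves_Suc:
  assumes "moves \<gamma> n x y"
  shows "moves \<gamma> (Suc n) x y"
proof -
  have "2 ^ Suc n * y - real (dyadic_index (Suc n) y) = 2 ^ Suc n * x - real (dyadic_index (Suc n) x)"
    using assms by (auto simp: moves_def dyadic_index_Suc algebra_simps)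
  then show ?thesis
    using assms by (simp add: moves_def dyadic_index_less_height_Suc label_Suc)
qed

lemma moves_mono:
  assumes "moves \<gamma> n x y" "n \<le> m"
  shows "moves \<gamma> m x y"
  using assms(2,1) by (induction rule: dec_induct) (auto intro: moves_Suc)

lemma moves_trans: "moves \<gamma> n x y \<Longrightarrow> moves \<delta> n y z \<Longrightarrow> moves (\<delta> + \<gamma>) n x z"
  by (simp add: moves_def algebra_simps)

text \<open>At a common later stage the label of the target fixes its level, by injectivity of
  \<open>p\<close>, and the relative position fixes the point in that level.\<close>

lemma moves_unique:
  assumes "moves \<gamma> n x y" "moves \<gamma> m x z"
  shows "y = z"
proof -
  have "moves \<gamma> (max n m) x y" "moves \<gamma> (max n m) x z"
    using assms by (auto intro: moves_mono)
  then have "dyadic_index (max n m) y = dyadic_index (max n m) z"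
    and "2 ^ max n m * y - real (dyadic_index (max n m) y) =
      2 ^ max n m * z - real (dyadic_index (max n m) z)"
    by (auto simp: moves_def label_def intro: p_inj)
  then show ?thesis
    by simp
qed

lemma moves_translate:
  assumes "i < height n" "i' < height n" "p n i' = p n i + \<gamma>" "x \<in> dyadic n i"
  shows "moves \<gamma> n x (x + (real i' - real i) / 2 ^ n)"
proof -
  let ?y = "x + (real i' - real i) / 2 ^ n"
  have y: "2 ^ n * ?y = 2 ^ n * x + (real i' - real i)"
    by (simp add: distrib_left)
  moreover have "?y \<in> dyadic n i'"
    using assms(4) unfolding mem_dyadic_iff y by simp
  ultimately show ?thesis
    using assms by (simp add: moves_def mem_dyadic label_def)
qed

lemma moves_imp_translate:
  assumes "moves \<gamma> n x y"
  shows "y = x + (real (dyadic_index n y) - real (dyadic_index n x)) / 2 ^ n"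
  using assms by (auto simp: moves_def field_simps)

lemma moves_exists:
  assumes "0 \<le> x"
  obtains n y where "moves \<gamma> n x y"
proof -
  have "\<forall>\<^sub>F n in sequentially. \<bar>\<gamma> $ j\<bar> < a n" for j
    using filterlim_a[unfolded filterlim_at_top, rule_format, of "\<bar>\<gamma> $ j\<bar> + 1"]
    by eventually_elim simp
  then have "\<forall>\<^sub>F n in sequentially. dyadic_index n x < height n \<and> (\<forall>j. \<bar>\<gamma> $ j\<bar> < a n)"
    using eventually_in_tower by (intro eventually_conj eventually_all_finite)
  then obtain n where n: "dyadic_index n x < height n" "\<And>j. \<bar>\<gamma> $ j\<bar> < a n"
    using eventually_happens trivial_limit_sequentially by blast
  \<comment> \<open>The next cube has room: the old label and \<open>\<gamma>\<close> are each
    bounded by \<open>a n\<close> in every coordinate, and \<open>a_Suc\<close> accommodates the sum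
    of both with \<open>c n\<close>.\<close>
  have "- a (Suc n) < (label (Suc n) x + \<gamma>) $ j \<and> (label (Suc n) x + \<gamma>) $ j \<le> a (Suc n)" for j
  proof -
    have "- a n < label n x $ j \<and> label n x $ j \<le> a n"
      using p_in_cube[OF n(1)] by (simp add: cube_def label_def)
    moreover have "\<bar>c n $ j\<bar> \<le> (\<Sum>j\<in>UNIV. \<bar>c n $ j\<bar>)"
      by (rule member_le_sum) auto
    ultimately show ?thesis
      using n(2)[of j] a_Suc[of n] by (auto simp: label_Suc[OF assms n(1)])
  qed
  then have "label (Suc n) x + \<gamma> \<in> cube (a (Suc n))"
    by (simp add: cube_def)
  then obtain i' where i': "i' < height (Suc n)" "p (Suc n) i' = label (Suc n) x + \<gamma>"
    by (rule p_surj)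
  show ?thesis
    using that moves_translate[of "dyadic_index (Suc n) x" "Suc n" i' \<gamma> x] i'
      dyadic_index_less_height_Suc[OF assms n(1)] assms
    by (simp add: label_def mem_dyadic)
qed

text \<open>The common extension of the partial translations of all towers. On the half-line the
  value exists by \<open>moves_exists\<close> and is unique by \<open>moves_unique\<close>; at
  negative points it is unspecified.\<close>

definition shift :: "int ^ 'd \<Rightarrow> real \<Rightarrow> real"
  where "shift \<gamma> x = (THE y. \<exists>n. moves \<gamma> n x y)"

lemma shift_eq: "moves \<gamma> n x y \<Longrightarrow> shift \<gamma> x = y"
  unfolding shift_def by (rule the_equality) (auto dest: moves_unique)

lemma moves_shift:
  assumes "0 \<le> x"
  shows "\<exists>n. moves \<gamma> n x (shift \<gamma> x)"
  using moves_exists[OF assms] shift_eq by metis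

lemma shift_nonneg: "0 \<le> x \<Longrightarrow> 0 \<le> shift \<gamma> x"
  using moves_shift[of x \<gamma>] by (auto simp: moves_def)

lemma shift_zero:
  assumes "0 \<le> x"
  shows "shift 0 x = x"
proof -
  obtain n where "moves 0 n x (shift 0 x)"
    using moves_shift[OF assms] by blast
  then have "moves 0 n x x"
    by (simp add: moves_def)
  then show ?thesis
    by (rule shift_eq)
qed

text \<open>Both moves persist to one common tower, where displacements of labels add.\<close>

lemma shift_add:
  assumes "0 \<le> x"
  shows "shift (\<gamma> + \<delta>) x = shift \<gamma> (shift \<delta> x)"
proof -
  obtain n m where "moves \<delta> n x (shift \<delta> x)" "moves \<gamma> m (shift \<delta> x) (shift \<gamma> (shift \<delta> x))"
    using moves_shift shift_nonneg assms by meson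
  then have "moves (\<gamma> + \<delta>) (max n m) x (shift \<gamma> (shift \<delta> x))"
    by (meson max.cobounded1 max.cobounded2 moves_mono moves_trans)
  then show ?thesis
    by (rule shift_eq)
qed

lemma shift_free:
  assumes "0 \<le> x" "\<gamma> \<noteq> 0"
  shows "shift \<gamma> x \<noteq> x"
  using moves_shift[OF assms(1), of \<gamma>] assms(2) by (auto simp: moves_def)

text \<open>On the half-line \<open>shift (- \<gamma>)\<close> inverts
  \<open>shift \<gamma>\<close>. Images thus become preimages, whose measurability and measure are
  accessible.\<close>

lemma shift_image_eq:
  assumes "A \<subseteq> {0..}"
  shows "shift \<gamma> ` A = shift (- \<gamma>) -` A \<inter> {0..}"
proof (intro equalityI subsetI)
  fix y assume "y \<in> shift \<gamma> ` A"
  then show "y \<in> shift (- \<gamma>) -` A \<inter> {0..}"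
    using assms shift_add[of _ "- \<gamma>" \<gamma>] by (auto simp: shift_zero shift_nonneg subset_iff)
next
  fix y assume y: "y \<in> shift (- \<gamma>) -` A \<inter> {0..}"
  then have "y = shift \<gamma> (shift (- \<gamma>) y)"
    using shift_add[of y \<gamma> "- \<gamma>"] by (simp add: shift_zero)
  then show "y \<in> shift \<gamma> ` A"
    using y by blast
qed

lemma shift_image_dyadic:
  assumes "i < height n" "i' < height n" "p n i' = p n i + \<gamma>"
  shows "shift \<gamma> ` dyadic n i = dyadic n i'"
proof -
  \<comment> \<open>Proved for arbitrary levels and displacements, because surjectivity comes from
    applying it backwards, with \<open>- \<gamma>\<close>.\<close>
  have *: "shift \<gamma> x \<in> dyadic n i'"
    if "i < height n" "i' < height n" "p n i' = p n i + \<gamma>" "x \<in> dyadic n i" for i i' \<gamma> x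
  proof -
    have m: "moves \<gamma> n x (shift \<gamma> x)"
      using moves_translate[OF that] shift_eq[OF moves_translate[OF that]] by simp
    then have "dyadic_index n (shift \<gamma> x) = i'"
      using that by (intro p_inj[of _ n]) (simp_all add: moves_def mem_dyadic label_def)
    then show ?thesis
      using m by (simp add: moves_def mem_dyadic)
  qed
  have "dyadic n i' \<subseteq> shift \<gamma> ` dyadic n i"
  proof
    fix y assume y: "y \<in> dyadic n i'"
    then have "shift (- \<gamma>) y \<in> dyadic n i"
      using assms by (intro *[of i' i]) simp_all
    moreover have "dyadic n i \<subseteq> {0..}"
      by (auto simp: mem_dyadic)
    ultimately show "y \<in> shift \<gamma> ` dyadic n i"
      using y by (simp add: shift_image_eq mem_dyadic)
  qed
  then show ?thesis
    using *[OF assms] by blast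
qed

end

section \<open>The half-line\<close>

definition half_line :: "real measure"
  where "half_line = restrict_space lborel {0..}"

lemma space_half_line [simp]: "space half_line = {0..}"
  by (simp add: half_line_def space_restrict_space)

lemma sets_half_line: "A \<in> sets half_line \<longleftrightarrow> A \<subseteq> {0..} \<and> A \<in> sets borel"
  by (simp add: half_line_def sets_restrict_space_iff)

lemma emeasure_half_line: "A \<subseteq> {0..} \<Longrightarrow> emeasure half_line A = emeasure lborel A"
  by (simp add: half_line_def emeasure_restrict_space)

lemma sigma_finite_half_line: "sigma_finite_measure half_line"
  unfolding half_line_def
  by (rule sigma_finite_measure_restrict_space) (simp_all add: lborel.sigma_finite_measure_axioms)

lemma emeasure_half_line_space: "emeasure half_line (space half_line) = \<infinity>"
proof -
  have "ennreal (real n) \<le> emeasure lborel {0::real..}" for n :: nat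
    using emeasure_mono[of "{0..real n}" "{0..}" lborel] by simp
  then have "emeasure lborel {0::real..} = \<infinity>"
    by (metis ennreal_of_nat_eq_real_of_nat ennreal_Ex_less_of_nat infinity_ennreal_def leD top.not_eq_extremum)
  then show ?thesis
    by (simp add: emeasure_half_line)
qed

lemma standard_borel_half_line: "standard_borel half_line"
  unfolding standard_borel_def
proof (intro exI[of _ "top_of_set {0..}"] conjI)
  let ?X = "top_of_set {0::real..}"
  show "completely_metrizable_space ?X"
    by (rule completely_metrizable_space_closedin[OF completely_metrizable_space_euclidean]) auto
  \<comment> \<open>Separability need not pass to subspaces; second countability does.\<close>
  have "second_countable (euclidean :: real topology)"
  proof -
    obtain \<B> :: "real set set" where \<B>: "countable \<B>" "topological_basis \<B>"
      using ex_countable_basis by blast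
    have "\<exists>V\<in>\<B>. x \<in> V \<and> V \<subseteq> U" if "open U" "x \<in> U" for U x
      using topological_basisE[OF \<B>(2) that] by blast
    then show ?thesis
      unfolding second_countable_def using \<B> topological_basis_open by (metis open_openin)
  qed
  then show "separable_space ?X"
    by (intro second_countable_imp_separable_space second_countable_subtopology)
  show "topspace ?X = space half_line"
    by simp
  have "sets half_line = (\<inter>) {0..} ` sigma_sets UNIV {S. open S}"
    by (simp add: half_line_def sets_restrict_space borel_def)
  also have "\<dots> = sigma_sets {0..} ((\<inter>) {0..} ` {S. open S})"
  proof (rule sigma_sets_Int)
    have "{0::real..} \<in> sets borel"
      by simp
    then show "{0::real..} \<in> sigma_sets UNIV {S. open S}"
      by (simp add: borel_def)
  qed simp
  also have "(\<inter>) {0..} ` {S. open S} = {U. openin ?X U}"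
    by (auto simp: openin_open)
  finally show "sets half_line = sigma_sets (topspace ?X) {U. openin ?X U}"
    by simp
qed

lemma emeasure_lborel_translate:
  fixes A :: "real set"
  assumes [measurable]: "A \<in> sets borel"
  shows "emeasure lborel ((+) s -` A) = emeasure lborel A"
proof -
  have "emeasure lborel A = emeasure (distr lborel borel ((+) s)) A"
    by (simp add: lborel_distr_plus)
  also have "\<dots> = emeasure lborel ((+) s -` A)"
    by (simp add: emeasure_distr)
  finally show ?thesis ..
qed

context dyadic_towers
begin

section \<open>The tower action\<close>

definition hits :: "int ^ 'd \<Rightarrow> nat \<Rightarrow> real set \<Rightarrow> real set"
  where "hits \<gamma> n A = {x. \<exists>y\<in>A. moves \<gamma> n x y}"

definition links :: "int ^ 'd \<Rightarrow> nat \<Rightarrow> (nat \<times> nat) set"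
  where "links \<gamma> n = {(i, i'). i < height n \<and> i' < height n \<and> p n i' = p n i + \<gamma>}"

lemma finite_links: "finite (links \<gamma> n)"
  by (rule finite_subset[of _ "{..<height n} \<times> {..<height n}"]) (auto simp: links_def)

text \<open>Between two linked levels the partial translation is an ordinary translation of the real
  line, so \<open>hits\<close> is a finite union of translated pieces of \<open>A\<close>.\<close>

lemma hits_eq:
  "hits \<gamma> n A = (\<Union>(i, i')\<in>links \<gamma> n. (+) ((real i' - real i) / 2 ^ n) -` (A \<inter> dyadic n i'))"
proof (intro equalityI subsetI)
  fix x assume "x \<in> hits \<gamma> n A"
  then obtain y where y: "y \<in> A" "moves \<gamma> n x y"
    by (auto simp: hits_def)
  then have "(dyadic_index n x, dyadic_index n y) \<in> links \<gamma> n" "y \<in> dyadic n (dyadic_index n y)"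
    by (auto simp: moves_def links_def label_def mem_dyadic)
  then show "x \<in> (\<Union>(i, i')\<in>links \<gamma> n. (+) ((real i' - real i) / 2 ^ n) -` (A \<inter> dyadic n i'))"
    using y(1) moves_imp_translate[OF y(2)] by (auto simp: add.commute intro!: bexI)
next
  fix x assume "x \<in> (\<Union>(i, i')\<in>links \<gamma> n. (+) ((real i' - real i) / 2 ^ n) -` (A \<inter> dyadic n i'))"
  then obtain i i' where i: "(i, i') \<in> links \<gamma> n" "x + (real i' - real i) / 2 ^ n \<in> A \<inter> dyadic n i'"
    by (auto simp: add.commute)
  moreover have "2 ^ n * (x + (real i' - real i) / 2 ^ n) = 2 ^ n * x + (real i' - real i)"
    by (simp add: distrib_left)
  ultimately have "x \<in> dyadic n i"
    by (simp add: mem_dyadic_iff)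
  then show "x \<in> hits \<gamma> n A"
    using i moves_translate[of i n i' \<gamma> x] by (auto simp: links_def hits_def)
qed

lemma hits_measurable:
  assumes [measurable]: "A \<in> sets borel"
  shows "hits \<gamma> n A \<in> sets borel"
proof -
  have "(+) s -` (A \<inter> dyadic n i') \<in> sets borel" for s i'
    using measurable_sets_borel[of "(+) s" borel "A \<inter> dyadic n i'"] by simp
  then show ?thesis
    unfolding hits_eq using finite_links by (auto intro!: sets.finite_UN)
qed

text \<open>Translates keep their measure, and distinct links have distinct target levels. The
  pieces of \<open>A\<close> that are hit are therefore disjoint.\<close>

lemma emeasure_hits_le:
  assumes [measurable]: "A \<in> sets borel"
  shows "emeasure lborel (hits \<gamma> n A) \<le> emeasure lborel A"
proof -
  let ?t = "\<lambda>(i, i'). (+) ((real i' - real i) / 2 ^ n) -` (A \<inter> dyadic n i')"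
  let ?u = "\<lambda>(i :: nat, i'). A \<inter> dyadic n i'"
  have "(+) s -` (A \<inter> dyadic n i') \<in> sets borel" for s i'
    using measurable_sets_borel[of "(+) s" borel "A \<inter> dyadic n i'"] by simp
  then have "emeasure lborel (hits \<gamma> n A) \<le> (\<Sum>k\<in>links \<gamma> n. emeasure lborel (?t k))"
    unfolding hits_eq using finite_links by (intro emeasure_subadditive_finite) auto
  also have "\<dots> = (\<Sum>k\<in>links \<gamma> n. emeasure lborel (?u k))"
    by (intro sum.cong refl)
      (simp add: split_beta emeasure_lborel_translate sets.Int assms del: vimage_Int)
  also have "\<dots> = emeasure lborel (\<Union>k\<in>links \<gamma> n. ?u k)"
  proof (rule sum_emeasure)
    show "disjoint_family_on ?u (links \<gamma> n)"
      unfolding disjoint_family_on_def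
    proof (intro ballI impI)
      fix k l assume "k \<in> links \<gamma> n" "l \<in> links \<gamma> n" "k \<noteq> l"
      then have "snd k \<noteq> snd l"
        by (auto simp: links_def dest: p_inj)
      then show "?u k \<inter> ?u l = {}"
        by (auto simp: mem_dyadic split_beta)
    qed
  qed (auto simp: finite_links)
  also have "\<dots> \<le> emeasure lborel A"
    by (intro emeasure_mono) auto
  finally show ?thesis .
qed

lemma incseq_hits: "incseq (\<lambda>n. hits \<gamma> n A)"
  by (auto simp: hits_def intro!: incseq_SucI dest: moves_Suc)

lemma shift_vimage_eq: "shift \<gamma> -` A \<inter> {0..} = (\<Union>n. hits \<gamma> n A)"
proof (intro equalityI subsetI)
  fix x assume "x \<in> shift \<gamma> -` A \<inter> {0..}"
  then show "x \<in> (\<Union>n. hits \<gamma> n A)"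
    using moves_shift[of x \<gamma>] by (auto simp: hits_def)
next
  fix x assume "x \<in> (\<Union>n. hits \<gamma> n A)"
  then obtain n y where "y \<in> A" "moves \<gamma> n x y"
    by (auto simp: hits_def)
  moreover from this have "0 \<le> x"
    by (simp add: moves_def)
  ultimately show "x \<in> shift \<gamma> -` A \<inter> {0..}"
    by (simp add: shift_eq)
qed

lemma shift_vimage_measurable: "A \<in> sets borel \<Longrightarrow> shift \<gamma> -` A \<inter> {0..} \<in> sets borel"
  unfolding shift_vimage_eq using hits_measurable by blast

lemma emeasure_shift_vimage_le:
  assumes "A \<in> sets borel"
  shows "emeasure lborel (shift \<gamma> -` A \<inter> {0..}) \<le> emeasure lborel A"
proof -
  have "emeasure lborel (shift \<gamma> -` A \<inter> {0..}) = (SUP n. emeasure lborel (hits \<gamma> n A))"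
    unfolding shift_vimage_eq using hits_measurable[OF assms]
    by (intro SUP_emeasure_incseq[symmetric] incseq_hits) auto
  also have "\<dots> \<le> emeasure lborel A"
    by (intro SUP_least emeasure_hits_le assms)
  finally show ?thesis .
qed

text \<open>One inequality is the limit of those for \<open>hits\<close>; the other is the same
  inequality for \<open>- \<gamma>\<close>, applied to the preimage of \<open>A\<close>.\<close>

lemma emeasure_shift_vimage:
  assumes "A \<subseteq> {0..}" "A \<in> sets borel"
  shows "emeasure lborel (shift \<gamma> -` A \<inter> {0..}) = emeasure lborel A"
proof (rule antisym)
  have "shift (- \<gamma>) -` (shift \<gamma> -` A \<inter> {0..}) \<inter> {0..} = A"
  proof (intro set_eqI iffI)
    fix x assume "x \<in> A"
    moreover have "shift \<gamma> (shift (- \<gamma>) x) = x" if "0 \<le> x"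
      using shift_add[OF that, of \<gamma> "- \<gamma>"] that by (simp add: shift_zero)
    ultimately show "x \<in> shift (- \<gamma>) -` (shift \<gamma> -` A \<inter> {0..}) \<inter> {0..}"
      using assms(1) by (auto simp: shift_nonneg)
  next
    fix x assume x: "x \<in> shift (- \<gamma>) -` (shift \<gamma> -` A \<inter> {0..}) \<inter> {0..}"
    then have "shift \<gamma> (shift (- \<gamma>) x) = x"
      using shift_add[of x \<gamma> "- \<gamma>"] by (simp add: shift_zero)
    then show "x \<in> A"
      using x by simp
  qed
  then show "emeasure lborel A \<le> emeasure lborel (shift \<gamma> -` A \<inter> {0..})"
    using emeasure_shift_vimage_le[of "shift \<gamma> -` A \<inter> {0..}" "- \<gamma>"] assms
    by (simp add: shift_vimage_measurable)
qed (rule emeasure_shift_vimage_le[OF assms(2)])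

lemma lattice_action_shift: "lattice_action half_line shift"
proof (intro lattice_action.intro lattice_action_axioms.intro)
  show "shift \<gamma> \<in> half_line \<rightarrow>\<^sub>M half_line" for \<gamma>
    by (rule measurableI) (auto simp: shift_nonneg sets_half_line shift_vimage_measurable)
  show "emeasure half_line (shift \<gamma> -` A \<inter> space half_line) = emeasure half_line A"
    if "A \<in> sets half_line" for A \<gamma>
    using that by (auto simp: emeasure_half_line sets_half_line emeasure_shift_vimage)
qed (auto simp: sigma_finite_half_line standard_borel_half_line shift_zero shift_add)

lemma free_action_shift: "free_action half_line shift"
  by (auto simp: free_action_def shift_free intro!: AE_I2)

section \<open>Rank one\<close>

text \<open>The inner approximation of \<open>U\<close> by whole levels of the \<open>n\<close>-th
  tower, which is the kind of set that rank one asks for.\<close>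

definition core :: "real set \<Rightarrow> nat \<Rightarrow> real set"
  where "core U n = (\<Union>i\<in>{i. i < height n \<and> dyadic n i \<subseteq> U}. dyadic n i)"

lemma core_borel [measurable]: "core U n \<in> sets borel"
  unfolding core_def by (intro sets.countable_UN') auto

lemma mem_core:
  "x \<in> core U n \<longleftrightarrow>
    0 \<le> x \<and> dyadic_index n x < height n \<and> dyadic n (dyadic_index n x) \<subseteq> U"
  by (auto simp: core_def mem_dyadic)

lemma core_subset: "core U n \<subseteq> U \<inter> {0..}"
  by (auto simp: core_def mem_dyadic)

lemma incseq_core: "incseq (core U)"
proof (rule incseq_SucI, rule subsetI)
  fix n x assume x: "x \<in> core U n"
  then have "dyadic (Suc n) (dyadic_index (Suc n) x) \<subseteq> dyadic n (dyadic_index n x)"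
    using dyadic_halves[of n "dyadic_index n x"] by (auto simp: mem_core dyadic_index_Suc)
  then show "x \<in> core U (Suc n)"
    using x by (auto simp: mem_core dyadic_index_less_height_Suc)
qed

text \<open>The lengths of the levels tend to 0 while the towers exhaust the half-line, so the level
  around a point of \<open>U\<close> eventually lies in \<open>U\<close>.\<close>

lemma UN_core:
  assumes "open U"
  shows "(\<Union>n. core U n) = U \<inter> {0..}"
proof (intro equalityI subsetI)
  fix x assume x: "x \<in> U \<inter> {0..}"
  then obtain e where e: "0 < e" "ball x e \<subseteq> U"
    using assms openE by blast
  have "(\<lambda>n. (1 / 2) ^ n :: real) \<longlonglongrightarrow> 0"
    by (rule LIMSEQ_realpow_zero) auto
  then have "\<forall>\<^sub>F n in sequentially. (1 / 2) ^ n < e"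
    using e(1) by (rule order_tendstoD)
  then have "\<forall>\<^sub>F n in sequentially. (1 / 2) ^ n < e \<and> dyadic_index n x < height n"
    using eventually_in_tower by (rule eventually_conj)
  then obtain n where n: "(1 / 2) ^ n < e" "dyadic_index n x < height n"
    using eventually_happens trivial_limit_sequentially by blast
  have "\<bar>x - y\<bar> < e" if "y \<in> dyadic n (dyadic_index n x)" for y
  proof -
    have "\<bar>2 ^ n * x - 2 ^ n * y\<bar> < 1"
      using that x dyadic_index_bounds[of x n] by (auto simp: mem_dyadic_iff)
    then have "2 ^ n * \<bar>x - y\<bar> < 1"
      by (simp flip: right_diff_distrib add: abs_mult)
    then have "\<bar>x - y\<bar> < (1 / 2) ^ n"
      by (simp add: field_simps)
    then show ?thesis
      using n(1) by simp
  qed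
  then have "dyadic n (dyadic_index n x) \<subseteq> ball x e"
    by (auto simp: dist_real_def)
  then show "x \<in> (\<Union>n. core U n)"
    using e n x by (auto simp: mem_core)
qed (use core_subset in blast)

text \<open>Outer regularity encloses \<open>A\<close> in an open \<open>U\<close> of small excess,
  and the cores exhaust \<open>U\<close> on the half-line. Finiteness of the measure of
  \<open>U\<close> permits continuity from above.\<close>

lemma eventually_core_approximates:
  assumes A: "A \<in> sets borel" "A \<subseteq> {0..}" "emeasure lborel A < \<infinity>" and "0 < e"
  shows "\<exists>U. \<forall>\<^sub>F n in sequentially. emeasure lborel (sym_diff A (core U n)) < e"
proof -
  \<comment> \<open>\<open>e\<close> may be infinite; a smaller \<open>e'\<close> is a real number
    and leaves room for the strict inequality.\<close>
  obtain e' where e': "0 < e'" "e' < e"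
    using dense[OF \<open>0 < e\<close>] by blast
  then obtain r where r: "0 < r" "e' = ennreal r"
    by (cases e') auto
  obtain U where U: "open U" "A \<subseteq> U" "emeasure lborel (U - A) < ennreal (r / 2)"
    using outer_regular_lborel[OF A(1), of "r / 2"] r by auto
  have [measurable]: "U \<in> sets borel" "A \<in> sets borel"
    using U A by auto
  have "emeasure lborel U \<le> emeasure lborel A + emeasure lborel (U - A)"
    using U(2) by (subst plus_emeasure) (auto intro!: emeasure_mono)
  also have "\<dots> < \<infinity>"
    using A(3) U(3) by (auto simp: less_top intro: less_trans)
  finally have U_fin: "emeasure lborel U < \<infinity>" .
  let ?D = "\<lambda>n. U \<inter> {0..} - core U n"
  have "(\<lambda>n. emeasure lborel (?D n)) \<longlonglongrightarrow> emeasure lborel (\<Inter>n. ?D n)"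
  proof (rule Lim_emeasure_decseq)
    show "decseq ?D"
      using incseq_core[of U] by (auto simp: incseq_def decseq_def)
    show "emeasure lborel (?D n) \<noteq> \<infinity>" for n
    proof -
      have "emeasure lborel (?D n) \<le> emeasure lborel U"
        by (intro emeasure_mono) auto
      then show ?thesis
        using U_fin by auto
    qed
  qed auto
  moreover have "(\<Inter>n. ?D n) = {}"
    using UN_core[OF U(1)] by auto
  ultimately have "(\<lambda>n. emeasure lborel (?D n)) \<longlonglongrightarrow> 0"
    by (metis emeasure_empty)
  then have "\<forall>\<^sub>F n in sequentially. emeasure lborel (?D n) < ennreal (r / 2)"
    using r(1) by (intro order_tendstoD(2)) auto
  then have "\<forall>\<^sub>F n in sequentially. emeasure lborel (sym_diff A (core U n)) < e"
  proof eventually_elim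
    fix n assume n: "emeasure lborel (?D n) < ennreal (r / 2)"
    have "emeasure lborel (sym_diff A (core U n)) \<le> emeasure lborel ((U - A) \<union> ?D n)"
      using core_subset[of U n] U(2) A(2) by (intro emeasure_mono) auto
    also have "\<dots> \<le> emeasure lborel (U - A) + emeasure lborel (?D n)"
      by (rule emeasure_subadditive) auto
    also have "\<dots> \<le> ennreal (r / 2) + ennreal (r / 2)"
      using U(3) n by (intro add_mono) auto
    also have "\<dots> = e'"
      using r by (simp flip: ennreal_plus)
    finally show "emeasure lborel (sym_diff A (core U n)) < e"
      using e'(2) by simp
  qed
  then show ?thesis ..
qed

lemma rank_one_shift: "rank_one half_line shift"
proof -
  have "(0 :: int ^ 'd) \<in> cube (a n)" for n
    using a_pos[of n] by (simp add: cube_def)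
  then have "\<exists>i. i < height n \<and> p n i = 0" for n
    using p_surj by metis
  \<comment> \<open>The base is the level labelled \<open>0\<close>, so that its image under
    \<open>shift \<gamma>\<close> is the level labelled \<open>\<gamma>\<close>.\<close>
  then obtain z where z: "z n < height n" "p n (z n) = 0" for n
    by metis
  let ?B = "\<lambda>n. dyadic n (z n)"
  have image: "shift (p n i) ` ?B n = dyadic n i" if "i < height n" for n i
    using that z by (intro shift_image_dyadic) auto
  have sub: "dyadic n i \<subseteq> {0..}" for n i
    by (auto simp: mem_dyadic)
  show ?thesis
    unfolding rank_one_def
  proof (intro exI[of _ a] exI[of _ ?B] conjI allI ballI impI)
    fix n
    show "?B n \<in> sets half_line" "0 < emeasure half_line (?B n)" "emeasure half_line (?B n) < \<infinity>"
      using sub by (auto simp: sets_half_line emeasure_half_line emeasure_dyadic)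
    show "disjoint_family_on (\<lambda>\<gamma>. shift \<gamma> ` ?B n) (cube (a n))"
      unfolding disjoint_family_on_def
    proof (intro ballI impI)
      fix \<gamma> \<delta> :: "int ^ 'd" assume "\<gamma> \<in> cube (a n)" "\<delta> \<in> cube (a n)" "\<gamma> \<noteq> \<delta>"
      moreover from this obtain i j where "i < height n" "p n i = \<gamma>" and "j < height n" "p n j = \<delta>"
        by (metis p_surj)
      ultimately have "shift \<gamma> ` ?B n = dyadic n i" "shift \<delta> ` ?B n = dyadic n j" "i \<noteq> j"
        using image by auto
      then show "shift \<gamma> ` ?B n \<inter> shift \<delta> ` ?B n = {}"
        by (auto simp: mem_dyadic)
    qed
  next
    fix A assume A: "A \<in> sets half_line" "emeasure half_line A < \<infinity>"
    let ?m = "\<lambda>n. MIN F\<in>Pow (cube (a n)). emeasure half_line (sym_diff A (\<Union>\<gamma>\<in>F. shift \<gamma> ` ?B n))"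
    have le: "?m n \<le> emeasure lborel (sym_diff A (core U n))" for n U
    proof -
      let ?I = "{i. i < height n \<and> dyadic n i \<subseteq> U}"
      \<comment> \<open>The minimum is tested on the labels of the levels that make up
        \<open>core U n\<close>.\<close>
      have "?m n \<le> emeasure half_line (sym_diff A (\<Union>\<gamma>\<in>p n ` ?I. shift \<gamma> ` ?B n))"
        using p_in_cube by (intro Min_le imageI) (auto simp: finite_cube)
      also have "(\<Union>\<gamma>\<in>p n ` ?I. shift \<gamma> ` ?B n) = core U n"
        by (simp add: core_def image)
      also have "emeasure half_line (sym_diff A (core U n)) = emeasure lborel (sym_diff A (core U n))"
        using A core_subset[of U n] by (intro emeasure_half_line) (auto simp: sets_half_line)
      finally show ?thesis .
    qed
    show "?m \<longlonglongrightarrow> 0"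
    proof (rule order_tendstoI)
      fix e :: ennreal assume "0 < e"
      then obtain U where "\<forall>\<^sub>F n in sequentially. emeasure lborel (sym_diff A (core U n)) < e"
        using eventually_core_approximates[of A e] A by (auto simp: sets_half_line emeasure_half_line)
      then show "\<forall>\<^sub>F n in sequentially. ?m n < e"
        by eventually_elim (rule le_less_trans[OF le])
    qed simp
  qed (rule filterlim_a)
qed

section \<open>Recurrence\<close>

text \<open>An averaging argument in place of the density theorem. Take an open \<open>U\<close>
  around \<open>A\<close> of measure less than twice that of \<open>A\<close>. If all levels inside
  \<open>U\<close> were at most half filled, summing over them would bound twice the measure of
  \<open>A \<inter> core U n\<close> by that of \<open>U\<close>, which fails for late
  \<open>n\<close>.\<close>

lemma eventually_dense_level:
  assumes A: "A \<in> sets borel" "A \<subseteq> {0..}" "0 < emeasure lborel A" "emeasure lborel A < \<infinity>"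
  shows "\<forall>\<^sub>F n in sequentially. \<exists>i<height n.
    emeasure lborel (dyadic n i) < 2 * emeasure lborel (A \<inter> dyadic n i)"
proof -
  have [measurable]: "A \<in> sets borel"
    by fact
  obtain r where r: "0 < r" "emeasure lborel A = ennreal r"
    using A(3,4) by (cases "emeasure lborel A") auto
  obtain U where U: "open U" "A \<subseteq> U" "emeasure lborel (U - A) < emeasure lborel A"
    using outer_regular_lborel[OF A(1) r(1)] r by auto
  have [measurable]: "U \<in> sets borel"
    using U by auto
  have "emeasure lborel U \<le> emeasure lborel A + emeasure lborel (U - A)"
    using U(2) by (subst plus_emeasure) (auto intro!: emeasure_mono)
  also have "\<dots> < emeasure lborel A + emeasure lborel A"
    using U(3) r by (intro ennreal_add_left_cancel_less[THEN iffD2]) auto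
  finally have U_less: "emeasure lborel U < 2 * emeasure lborel A"
    by (simp add: mult_2)
  have "(\<lambda>n. emeasure lborel (A \<inter> core U n)) \<longlonglongrightarrow> emeasure lborel (\<Union>n. A \<inter> core U n)"
    using incseq_core[of U] by (intro Lim_emeasure_incseq) (auto simp: incseq_def)
  moreover have "(\<Union>n. A \<inter> core U n) = A"
    using UN_core[OF U(1)] U(2) A(2) by blast
  ultimately have "(\<lambda>n. 2 * emeasure lborel (A \<inter> core U n)) \<longlonglongrightarrow> 2 * emeasure lborel A"
    by (intro ennreal_tendsto_cmult) auto
  then have "\<forall>\<^sub>F n in sequentially. emeasure lborel U < 2 * emeasure lborel (A \<inter> core U n)"
    using U_less by (rule order_tendstoD)
  then show ?thesis
  proof eventually_elim
    fix n assume n: "emeasure lborel U < 2 * emeasure lborel (A \<inter> core U n)"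
    let ?I = "{i. i < height n \<and> dyadic n i \<subseteq> U}"
    show "\<exists>i<height n. emeasure lborel (dyadic n i) < 2 * emeasure lborel (A \<inter> dyadic n i)"
    proof (rule ccontr)
      assume "\<not> ?thesis"
      then have *: "\<forall>i<height n. 2 * emeasure lborel (A \<inter> dyadic n i) \<le> emeasure lborel (dyadic n i)"
        by (meson not_less)
      have "2 * emeasure lborel (A \<inter> core U n) =
          2 * emeasure lborel (\<Union>i\<in>?I. A \<inter> dyadic n i)"
        by (simp add: core_def)
      also have "\<dots> = (\<Sum>i\<in>?I. 2 * emeasure lborel (A \<inter> dyadic n i))"
        by (subst sum_emeasure[symmetric]) (auto simp: disjoint_family_on_def mem_dyadic sum_distrib_left)
      also have "\<dots> \<le> (\<Sum>i\<in>?I. emeasure lborel (dyadic n i))"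
        using * by (intro sum_mono) auto
      also have "\<dots> = emeasure lborel (core U n)"
        unfolding core_def by (rule sum_emeasure) (auto simp: disjoint_family_on_def mem_dyadic)
      also have "\<dots> \<le> emeasure lborel U"
        using core_subset[of U n] by (intro emeasure_mono) auto
      finally show False
        using n by simp
    qed
  qed
qed

text \<open>The first two levels of the next tower have labels differing by \<open>c n\<close>, and
  \<open>p\<close> is injective.\<close>

lemma c_nonzero: "c n \<noteq> 0"
proof
  assume "c n = 0"
  then have "p (Suc n) (2 * 0 + 1) = p (Suc n) (2 * 0)"
    using p_even[of 0 n] p_odd[of 0 n] height_pos[of n] by (simp add: height_def)
  then show False
    using p_inj[of 1 "Suc n" 0] height_pos[of n] height_Suc[of n] by simp
qed

lemma emeasure_shift_image:
  assumes "A \<subseteq> {0..}" "A \<in> sets borel"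
  shows "shift \<gamma> ` A \<in> sets borel" "emeasure lborel (shift \<gamma> ` A) = emeasure lborel A"
  using assms by (simp_all add: shift_image_eq shift_vimage_measurable emeasure_shift_vimage)

text \<open>
  A set filling more than half of a level overlaps itself when one half of the level is moved onto
  the other.
\<close>

lemma recurrent_dense_level:
  assumes A: "A \<in> sets borel" "A \<subseteq> {0..}" and "i < height n"
    and dense: "emeasure lborel (dyadic n i) < 2 * emeasure lborel (A \<inter> dyadic n i)"
  shows "0 < emeasure lborel (A \<inter> shift (c n) ` A)"
proof (rule ccontr)
  let ?P = "A \<inter> dyadic (Suc n) (2 * i)" and ?Q = "A \<inter> dyadic (Suc n) (2 * i + 1)"
  let ?P' = "shift (c n) ` ?P"
  assume "\<not> ?thesis"
  then have null: "emeasure lborel (A \<inter> shift (c n) ` A) = 0"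
    by (simp add: zero_less_iff_neq_zero)
  have [measurable]: "A \<in> sets borel"
    by fact
  have P': "?P' \<in> sets borel" "emeasure lborel ?P' = emeasure lborel ?P"
    using emeasure_shift_image[of ?P "c n"] A by auto
  have "shift (c n) ` dyadic (Suc n) (2 * i) = dyadic (Suc n) (2 * i + 1)"
    using assms(3) height_Suc[of n] p_even[of i n] p_odd[of i n]
    by (intro shift_image_dyadic) (simp_all add: height_def)
  then have sub: "?P' \<subseteq> dyadic (Suc n) (2 * i + 1)"
    by blast
  have sA: "shift (c n) ` A \<in> sets borel"
    using emeasure_shift_image(1)[OF A(2,1)] .
  have "emeasure lborel (?P' \<inter> ?Q) \<le> emeasure lborel (A \<inter> shift (c n) ` A)"
    using sA by (intro emeasure_mono) auto
  then have "emeasure lborel (?P' \<inter> ?Q) = 0"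
    using null by simp
  \<comment> \<open>\<open>?P'\<close> and \<open>?Q\<close> both lie in the right half and overlap
    in a null set, so together they measure at most half the level.\<close>
  have "emeasure lborel (A \<inter> dyadic n i) = emeasure lborel (?P \<union> ?Q)"
    using dyadic_halves[of n i] by (intro arg_cong[where f = "emeasure lborel"]) blast
  also have "\<dots> \<le> emeasure lborel ?P + emeasure lborel ?Q"
    by (rule emeasure_subadditive) auto
  also have "\<dots> = emeasure lborel (?P' \<union> ?Q) + emeasure lborel (?P' \<inter> ?Q)"
    using P' by (subst emeasure_Un_Int[of ?P' lborel ?Q, symmetric]) auto
  also have "\<dots> = emeasure lborel (?P' \<union> ?Q)"
    using \<open>emeasure lborel (?P' \<inter> ?Q) = 0\<close> by simp
  also have "\<dots> \<le> emeasure lborel (dyadic (Suc n) (2 * i + 1))"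
    using sub by (intro emeasure_mono) auto
  finally have "2 * emeasure lborel (A \<inter> dyadic n i) \<le> 2 * ennreal (1 / 2 ^ Suc n)"
    by (intro mult_left_mono) (auto simp: emeasure_dyadic)
  also have "\<dots> = emeasure lborel (dyadic n i)"
    by (simp add: emeasure_dyadic flip: ennreal_numeral ennreal_mult)
  finally show False
    using dense by simp
qed

lemma recurrent_along_shift:
  assumes "\<And>e. 0 < e \<Longrightarrow> \<exists>\<^sub>F n in sequentially. \<exists>g\<in>\<theta>. dist (real_vec (c n)) g < e"
  shows "recurrent_along half_line shift \<theta>"
  unfolding recurrent_along_def
proof (intro allI ballI impI)
  fix e :: real and A assume "0 < e" "A \<in> sets half_line" "0 < emeasure half_line A"
  then have A: "A \<in> sets borel" "A \<subseteq> {0..}" "0 < emeasure lborel A"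
    by (auto simp: sets_half_line emeasure_half_line)
  have [measurable]: "A \<in> sets borel"
    by fact
  \<comment> \<open>Truncation to a bounded part, because dense levels are found for sets of finite
    measure.\<close>
  have "\<exists>k. 0 < emeasure lborel (A \<inter> {0..real k})"
  proof (rule ccontr)
    assume "\<nexists>k. 0 < emeasure lborel (A \<inter> {0..real k})"
    then have "emeasure lborel (\<Union>k. A \<inter> {0..real k}) = 0"
      by (intro emeasure_UN_eq_0) (auto simp: zero_less_iff_neq_zero)
    moreover have "(\<Union>k. A \<inter> {0..real k}) = A"
      using A(2) real_arch_simple by (auto simp: subset_iff)
    ultimately show False
      using A(3) by simp
  qed
  then obtain k where k: "0 < emeasure lborel (A \<inter> {0..real k})"
    by blast
  have "emeasure lborel (A \<inter> {0..real k}) \<le> emeasure lborel {0..real k}"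
    by (intro emeasure_mono) auto
  also have "\<dots> < \<infinity>"
    by simp
  finally have "\<forall>\<^sub>F n in sequentially. \<exists>i<height n. emeasure lborel (dyadic n i) <
      2 * emeasure lborel ((A \<inter> {0..real k}) \<inter> dyadic n i)"
    using k by (intro eventually_dense_level) auto
  with assms[OF \<open>0 < e\<close>] have "\<exists>\<^sub>F n in sequentially. (\<exists>i<height n. emeasure lborel (dyadic n i) <
      2 * emeasure lborel ((A \<inter> {0..real k}) \<inter> dyadic n i)) \<and>
      (\<exists>g\<in>\<theta>. dist (real_vec (c n)) g < e)"
    by (rule frequently_eventually_conj)
  then obtain n i where n: "\<exists>g\<in>\<theta>. dist (real_vec (c n)) g < e" "i < height n"
      "emeasure lborel (dyadic n i) < 2 * emeasure lborel ((A \<inter> {0..real k}) \<inter> dyadic n i)"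
    using frequently_ex by blast
  have "0 < emeasure lborel ((A \<inter> {0..real k}) \<inter> shift (c n) ` (A \<inter> {0..real k}))"
    using n by (intro recurrent_dense_level) auto
  also have "\<dots> \<le> emeasure lborel (A \<inter> shift (c n) ` A)"
    using emeasure_shift_image(1)[OF A(2,1)] by (intro emeasure_mono) auto
  also have "\<dots> = emeasure half_line (A \<inter> shift (c n) ` A)"
    using A(2) by (intro emeasure_half_line[symmetric]) auto
  finally show "\<exists>\<gamma>. \<gamma> \<noteq> 0 \<and> (\<exists>g\<in>\<theta>. dist (real_vec \<gamma>) g < e) \<and>
      0 < emeasure half_line (A \<inter> shift \<gamma> ` A)"
    using n(1) c_nonzero by blast
qed

text \<open>The difference of labels starts at 0 and changes by \<open>0\<close> or
  \<open>\<plusminus> c n\<close> at stage \<open>n\<close>. Being of norm at most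
  \<open>a n\<close> beforehand, it cannot compensate the distance \<open>a n + 1\<close> of
  \<open>c n\<close> from the line, so after a nonzero change it is at distance at least 1. A zero
  change keeps the earlier alternative.\<close>

lemma return_time_bounds:
  assumes "subspace \<theta>" and "m \<le> n"
    and far: "\<And>k g. m \<le> k \<Longrightarrow> g \<in> \<theta> \<Longrightarrow> real_of_int (a k) + 1 \<le> dist (real_vec (c k)) g"
    and xy: "x \<in> dyadic m i" "y \<in> dyadic m i" "i < height m"
  shows "norm (real_vec (label n y - label n x)) \<le> real_of_int (a n) \<and>
    (label n y = label n x \<or> (\<forall>g\<in>\<theta>. 1 \<le> dist (real_vec (label n y - label n x)) g)) \<and>
    dyadic_index n x < height n \<and> dyadic_index n y < height n"
  using \<open>m \<le> n\<close>
proof (induction rule: dec_induct)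
  case base
  then show ?case
    using xy a_pos[of m] by (simp add: mem_dyadic label_def real_vec_zero)
next
  case (step n)
  have c_norm: "norm (real_vec (c n)) \<le> real_of_int (a (Suc n)) - 2 * real_of_int (a n)"
    using norm_real_vec_le[of "c n"] a_Suc[of n] by linarith
  have a: "0 < real_of_int (a n)"
    using a_pos[of n] by simp
  let ?u = "label n y - label n x" and ?v = "label (Suc n) y - label (Suc n) x"
  have nonneg: "0 \<le> x" "0 \<le> y"
    using xy by (auto simp: mem_dyadic)
  have "?v = ?u \<or> ?v = ?u + c n \<or> ?v = ?u - c n"
    using step.IH nonneg by (auto simp: label_Suc)
  then consider "?v = ?u" | "?v = ?u + c n" | "?v = ?u - c n"
    by blast
  then have "norm (real_vec ?v) \<le> real_of_int (a (Suc n)) \<and>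
    (?v = 0 \<or> (\<forall>g\<in>\<theta>. 1 \<le> dist (real_vec ?v) g))"
  proof cases
    case 1
    then show ?thesis
      using step.IH a_double[of n] a_pos[of n] unfolding 1 by auto
  next
    case 2
    have n: "norm (real_vec ?v) \<le> norm (real_vec ?u) + norm (real_vec (c n))"
      unfolding 2 real_vec_add by (rule norm_triangle_ineq)
    have "1 \<le> dist (real_vec ?v) g" if "g \<in> \<theta>" for g
    proof -
      have "real_of_int (a n) + 1 \<le> dist (real_vec (c n)) g"
        using far step.hyps that by auto
      also have "\<dots> \<le> dist (real_vec ?v) g + norm (real_vec ?u)"
        unfolding 2 real_vec_add dist_norm
        using norm_triangle_ineq4[of "real_vec ?u + real_vec (c n) - g" "real_vec ?u"] by simp
      finally show ?thesis
        using step.IH by simp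
    qed
    then show ?thesis
      using n step.IH c_norm a by auto
  next
    case 3
    then have v: "real_vec ?v = real_vec ?u - real_vec (c n)"
      using real_vec_add[of ?u "- c n"] by (simp add: real_vec_minus)
    have n: "norm (real_vec ?v) \<le> norm (real_vec ?u) + norm (real_vec (c n))"
      unfolding v by (rule norm_triangle_ineq4)
    have "1 \<le> dist (real_vec ?v) g" if "g \<in> \<theta>" for g
    proof -
      \<comment> \<open>The line is symmetric, so \<open>- c n\<close> is as far from it as
        \<open>c n\<close>.\<close>
      have "- g \<in> \<theta>"
        using that assms(1) by (simp add: subspace_neg)
      then have "real_of_int (a n) + 1 \<le> dist (real_vec (c n)) (- g)"
        using far step.hyps by auto
      also have "\<dots> \<le> dist (real_vec ?v) g + norm (real_vec ?u)"
        unfolding v dist_norm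
        using norm_triangle_ineq4[of "real_vec ?u" "real_vec ?u - real_vec (c n) - g"]
        by (simp add: add.commute)
      finally show ?thesis
        using step.IH by simp
    qed
    then show ?thesis
      using n step.IH c_norm a by auto
  qed
  then show ?case
    using step.IH nonneg by (auto simp: dyadic_index_less_height_Suc)
qed

lemma not_recurrent_along_shift:
  assumes "subspace \<theta>"
    and "\<forall>\<^sub>F n in sequentially. \<forall>g\<in>\<theta>. real_of_int (a n) + 1 \<le> dist (real_vec (c n)) g"
  shows "\<not> recurrent_along half_line shift \<theta>"
proof
  assume rec: "recurrent_along half_line shift \<theta>"
  obtain m where m: "\<And>n g. m \<le> n \<Longrightarrow> g \<in> \<theta> \<Longrightarrow> real_of_int (a n) + 1 \<le> dist (real_vec (c n)) g"
    using assms(2) by (auto simp: eventually_sequentially)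
  \<comment> \<open>A level of a tower from which on all translations are far: by
    \<open>return_time_bounds\<close>, its nonzero return times stay at distance at least 1 from the
    line.\<close>
  let ?A = "dyadic m 0"
  have "?A \<subseteq> {0..}"
    by (auto simp: mem_dyadic)
  then have "?A \<in> sets half_line" "0 < emeasure half_line ?A"
    by (auto simp: sets_half_line emeasure_half_line emeasure_dyadic)
  then obtain \<gamma> g where \<gamma>: "\<gamma> \<noteq> 0" "g \<in> \<theta>" "dist (real_vec \<gamma>) g < 1"
      "0 < emeasure half_line (?A \<inter> shift \<gamma> ` ?A)"
    using rec unfolding recurrent_along_def by (metis zero_less_one)
  then have "?A \<inter> shift \<gamma> ` ?A \<noteq> {}"
    by (metis emeasure_empty less_irrefl)
  then obtain x where x: "x \<in> ?A" "shift \<gamma> x \<in> ?A"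
    by blast
  then obtain n where "moves \<gamma> n x (shift \<gamma> x)"
    using moves_shift[of x \<gamma>] by (auto simp: mem_dyadic)
  then have "label (max n m) (shift \<gamma> x) - label (max n m) x = \<gamma>"
    using moves_mono[of \<gamma> n x "shift \<gamma> x" "max n m"] by (auto simp: moves_def)
  then show False
    using return_time_bounds[OF assms(1) max.cobounded2 m x height_pos, of n] \<gamma> by fastforce
qed

end

section \<open>Existence of towers\<close>

text \<open>The enumerations of \<open>F\<close> and of its translate are interleaved, and the rest
  of \<open>F'\<close> is appended. Injectivity of the interleaving follows by counting.\<close>

lemma extend_enumeration:
  fixes p :: "nat \<Rightarrow> 'v::ab_group_add"
  assumes "finite F'" and sub: "F \<union> (+) c ` F \<subseteq> F'" and disj: "F \<inter> (+) c ` F = {}"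
    and p: "bij_betw p {..<card F} F"
  shows "\<exists>p'. bij_betw p' {..<card F'} F' \<and>
    (\<forall>i<card F. p' (2 * i) = p i \<and> p' (2 * i + 1) = p i + c)"
proof -
  let ?G = "F \<union> (+) c ` F"
  have "finite F"
    using sub \<open>finite F'\<close> finite_subset by blast
  have "card ?G = card F + card ((+) c ` F)"
    using disj \<open>finite F\<close> by (intro card_Un_disjoint) auto
  then have card_G: "card ?G = 2 * card F"
    by (simp add: card_image)
  define g where "g i = p (i div 2) + (if even i then 0 else c)" for i
  have g_even: "g (2 * i) = p i" and g_odd: "g (2 * i + 1) = p i + c" for i
    by (simp_all add: g_def)
  have "g ` {..<2 * card F} = ?G"
  proof (intro equalityI subsetI)
    fix x assume "x \<in> g ` {..<2 * card F}"
    then obtain i where "i < 2 * card F" "x = g i"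
      by blast
    then have "p (i div 2) \<in> F" "x = p (i div 2) \<or> x = c + p (i div 2)"
      using p by (auto simp: bij_betw_def g_def add.commute)
    then show "x \<in> ?G"
      by blast
  next
    fix x assume "x \<in> ?G"
    then obtain y where y: "y \<in> F" "x = y \<or> x = c + y"
      by blast
    have "y \<in> p ` {..<card F}"
      using p y(1) by (simp add: bij_betw_def)
    then obtain i where "i < card F" "p i = y"
      by blast
    then have "x = g (2 * i) \<and> 2 * i < 2 * card F \<or> x = g (2 * i + 1) \<and> 2 * i + 1 < 2 * card F"
      using y(2) g_odd[of i] by (auto simp: g_even add.commute)
    then show "x \<in> g ` {..<2 * card F}"
      by blast
  qed
  then have "bij_betw g {..<2 * card F} ?G"
    using card_G by (simp add: bij_betw_def eq_card_imp_inj_on)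
  moreover obtain h where "bij_betw h {2 * card F..<card F'} (F' - ?G)"
    using finite_same_card_bij[of "{2 * card F..<card F'}" "F' - ?G"] \<open>finite F'\<close> \<open>finite F\<close> sub card_G
    by (auto simp: card_Diff_subset)
  moreover define p' where "p' i = (if i < 2 * card F then g i else h i)" for i
  ultimately have "bij_betw p' {..<2 * card F} ?G" "bij_betw p' {2 * card F..<card F'} (F' - ?G)"
    using bij_betw_cong[of "{..<2 * card F}" p' g] bij_betw_cong[of "{2 * card F..<card F'}" p' h]
    by auto
  then have "bij_betw p' ({..<2 * card F} \<union> {2 * card F..<card F'}) (?G \<union> (F' - ?G))"
    by (rule bij_betw_combine) auto
  moreover have "2 * card F \<le> card F'"
    using card_mono[OF \<open>finite F'\<close> sub] card_G by simp
  ultimately have "bij_betw p' {..<card F'} F'"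
    using sub by (simp add: ivl_disj_un Un_absorb1)
  moreover have "p' (2 * i) = p i \<and> p' (2 * i + 1) = p i + c" if "i < card F" for i
    using that g_even[of i] g_odd[of i] by (simp add: p'_def)
  ultimately show ?thesis
    by blast
qed

text \<open>By \<open>large\<close>, some coordinate of \<open>c n\<close> is at least the side of
  the cube, so the cube and its translate are disjoint; by \<open>a_Suc\<close> both fit into the
  next cube.\<close>

lemma dyadic_towers_exist:
  fixes a :: "nat \<Rightarrow> int" and c :: "nat \<Rightarrow> int ^ 'd"
  assumes "CARD('d) \<ge> 2" and "1 \<le> a 0"
    and a_Suc: "\<And>n. 2 * a n + (\<Sum>j\<in>UNIV. \<bar>c n $ j\<bar>) \<le> a (Suc n)"
    and large: "\<And>n. \<exists>j. 2 * a n \<le> \<bar>c n $ j\<bar>"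
  shows "\<exists>p. dyadic_towers a c p"
proof -
  let ?F = "\<lambda>n. cube (a n) :: (int ^ 'd) set"
  have "\<exists>p. \<forall>n. bij_betw (p n) {..<card (?F n)} (?F n) \<and>
    (\<forall>i<card (?F n). p (Suc n) (2 * i) = p n i \<and> p (Suc n) (2 * i + 1) = p n i + c n)"
  proof (rule dependent_nat_choice)
    show "\<exists>p. bij_betw p {..<card (?F 0)} (?F 0)"
      using finite_same_card_bij[of "{..<card (?F 0)}" "?F 0"] by (simp add: finite_cube)
  next
    fix p n assume p: "bij_betw p {..<card (?F n)} (?F n)"
    have c_le: "\<bar>c n $ j\<bar> \<le> (\<Sum>j\<in>UNIV. \<bar>c n $ j\<bar>)" for j
      by (rule member_le_sum) auto
    have "x \<in> ?F (Suc n)" if "x \<in> ?F n \<union> (+) (c n) ` ?F n" for x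
      unfolding cube_def
    proof (intro CollectI allI)
      fix j
      obtain y where y: "y \<in> ?F n" "x = y \<or> x = c n + y"
        using \<open>x \<in> _\<close> by blast
      have "- a n < y $ j" "y $ j \<le> a n"
        using y(1) by (auto simp: cube_def)
      then show "- a (Suc n) < x $ j \<and> x $ j \<le> a (Suc n)"
        using y(2) a_Suc[of n] c_le[of j] by auto
    qed
    moreover have "?F n \<inter> (+) (c n) ` ?F n = {}"
    proof (rule ccontr)
      assume "?F n \<inter> (+) (c n) ` ?F n \<noteq> {}"
      then obtain y where y: "y \<in> ?F n" "c n + y \<in> ?F n"
        by blast
      obtain j where "2 * a n \<le> \<bar>c n $ j\<bar>"
        using large by blast
      moreover have "- a n < y $ j" "y $ j \<le> a n" "- a n < c n $ j + y $ j" "c n $ j + y $ j \<le> a n"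
        using y by (auto simp: cube_def)
      ultimately show False
        by linarith
    qed
    ultimately show "\<exists>p'. bij_betw p' {..<card (?F (Suc n))} (?F (Suc n)) \<and>
        (\<forall>i<card (?F n). p' (2 * i) = p i \<and> p' (2 * i + 1) = p i + c n)"
      using p by (intro extend_enumeration) (auto simp: finite_cube)
  qed
  then obtain p where "\<And>n. bij_betw (p n) {..<card (?F n)} (?F n)"
    "\<And>n i. i < card (?F n) \<Longrightarrow> p (Suc n) (2 * i) = p n i \<and> p (Suc n) (2 * i + 1) = p n i + c n"
    by blast
  then show ?thesis
    using assms by (intro exI[of _ p] dyadic_towers.intro) auto
qed

text \<open>
  The translation \<open>c n\<close> may be chosen knowing the size \<open>a n\<close> of the \<open>n\<close>-th cube, whose own size
  depends on \<open>c 0, \<dots>, c (n - 1)\<close> only.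
\<close>

lemma towers_of_choice:
  fixes pick :: "nat \<Rightarrow> int \<Rightarrow> int ^ 'd"
  assumes "CARD('d) \<ge> 2" and "\<And>n b. \<exists>j. 2 * b \<le> \<bar>pick n b $ j\<bar>"
  obtains a p where "dyadic_towers a (\<lambda>n. pick n (a n)) p"
proof -
  define a where "a = rec_nat 1 (\<lambda>n b. 2 * b + (\<Sum>j\<in>UNIV. \<bar>pick n b $ j\<bar>))"
  have "a 0 = 1" "a (Suc n) = 2 * a n + (\<Sum>j\<in>UNIV. \<bar>pick n (a n) $ j\<bar>)" for n
    by (simp_all add: a_def)
  then show ?thesis
    using that assms dyadic_towers_exist[of a "\<lambda>n. pick n (a n)"] by auto
qed

section \<open>Lattice points near a line\<close>

lemma span_eq_projective_line:
  assumes "\<theta> \<in> projective_space" "x \<in> \<theta>" "x \<noteq> 0"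
  shows "span {x} = \<theta>"
  using assms
  by (intro subspace_dim_equal) (auto simp: projective_space_def span_minimal dim_singleton)

lemma projective_line_spanned:
  assumes "\<theta> \<in> projective_space"
  obtains x where "x \<noteq> 0" "\<theta> = span {x}"
proof -
  have "\<not> \<theta> \<subseteq> {0}"
    using assms dim_eq_0[of \<theta>] by (simp add: projective_space_def)
  then show ?thesis
    using that span_eq_projective_line[OF assms] by blast
qed

text \<open>Simultaneous Diophantine approximation: the fractional parts of the multiples of
  \<open>v\<close> stay in a compact cube, so two multiples with arbitrarily distant indices have
  nearly equal fractional parts, and their difference is near a lattice point.\<close>

lemma lattice_point_near_multiple:
  fixes v :: "real ^ 'd"
  assumes "0 < e"
  shows "\<exists>\<gamma> t. L \<le> t \<and> dist (real_vec \<gamma>) (t *\<^sub>R v) < e"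
proof -
  define x where "x k = (\<chi> j. frac (real k * v $ j))" for k :: nat
  have "range x \<subseteq> cbox 0 (\<chi> j. 1)"
    by (auto simp: x_def mem_box_cart frac_lt_1 less_imp_le)
  then have "bounded (range x)"
    using bounded_cbox bounded_subset by blast
  then obtain l r where r: "strict_mono r" "(x \<circ> r) \<longlonglongrightarrow> l"
    using bounded_imp_convergent_subsequence by blast
  then have "Cauchy (x \<circ> r)"
    by (intro LIMSEQ_imp_Cauchy)
  then obtain N where N: "\<And>m n. N \<le> m \<Longrightarrow> N \<le> n \<Longrightarrow> dist (x (r m)) (x (r n)) < e"
    using assms unfolding Cauchy_def by (metis comp_apply)
  obtain k :: nat where k: "L \<le> real k"
    using real_arch_simple by blast
  define s t where "s = r N" and "t = r (N + k)"
  have "r N + k \<le> r (N + k)" for k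
  proof (induction k)
    case (Suc k)
    then show ?case
      using strict_monoD[OF r(1), of "N + k" "N + Suc k"] by simp
  qed simp
  from this[of k] have "real k + real s \<le> real t"
    by (simp add: s_def t_def)
  then have "L \<le> real t - real s"
    using k by linarith
  moreover have "(real t - real s) *\<^sub>R v - real_vec (\<chi> j. \<lfloor>real t * v $ j\<rfloor> - \<lfloor>real s * v $ j\<rfloor>) = x t - x s"
    by (simp add: vec_eq_iff x_def real_vec_def frac_def algebra_simps)
  then have "dist (real_vec (\<chi> j. \<lfloor>real t * v $ j\<rfloor> - \<lfloor>real s * v $ j\<rfloor>)) ((real t - real s) *\<^sub>R v) < e"
    using N[of "N + k" N] by (simp add: dist_norm norm_minus_commute s_def t_def)
  ultimately show ?thesis
    by blast
qed

text \<open>A ball of radius \<open>\<delta>\<close> around \<open>v\<close> contains only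
  directions from \<open>U\<close>. Scaling by \<open>t\<close>, all lines outside \<open>U\<close>
  stay at distance at least \<open>t * \<delta>\<close> from \<open>t *\<^sub>R v\<close>, and
  \<open>\<gamma>\<close> is close to that point.\<close>

lemma lattice_point_avoiding:
  fixes \<theta> :: "(real ^ 'd) set"
  assumes U: "openin projective_topology U" "\<theta> \<in> U" and "0 < e"
  shows "\<exists>\<gamma>. (\<exists>g\<in>\<theta>. dist (real_vec \<gamma>) g < e) \<and> (\<exists>j. 2 * b \<le> \<bar>\<gamma> $ j\<bar>) \<and>
    (\<forall>\<eta>\<in>projective_space - U. \<forall>g\<in>\<eta>. real_of_int b + 1 \<le> dist (real_vec \<gamma>) g)"
proof -
  have "\<theta> \<in> projective_space"
    using U openin_projective_topology by blast
  then obtain v where v: "v \<noteq> 0" "\<theta> = span {v}"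
    by (rule projective_line_spanned)
  then obtain j where j: "v $ j \<noteq> 0"
    by (auto simp: vec_eq_iff)
  let ?S = "{x. x \<noteq> 0 \<and> span {x} \<in> U}"
  have "open ?S" "v \<in> ?S"
    using U v by (auto simp: openin_projective_topology)
  then obtain \<delta> where \<delta>: "0 < \<delta>" "ball v \<delta> \<subseteq> ?S"
    using openE by blast
  \<comment> \<open>The three bounds make \<open>t\<close> positive, make the \<open>j\<close>-th
    coordinate of \<open>t *\<^sub>R v\<close> at least \<open>2 * b + 1\<close> in absolute value,
    and give \<open>t * \<delta> \<ge> b + 2\<close>; the spare 1 absorbs the error of
    \<open>\<gamma>\<close>.\<close>
  define L where "L = max 1 (max ((2 * real_of_int b + 1) / \<bar>v $ j\<bar>) ((real_of_int b + 2) / \<delta>))"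
  obtain \<gamma> t where t: "L \<le> t" "dist (real_vec \<gamma>) (t *\<^sub>R v) < min e 1"
    using lattice_point_near_multiple[of "min e 1" L v] \<open>0 < e\<close> by auto
  have "1 \<le> t" and t1: "(2 * real_of_int b + 1) / \<bar>v $ j\<bar> \<le> t" and t2: "(real_of_int b + 2) / \<delta> \<le> t"
    using t(1) by (auto simp: L_def)
  have near: "dist (real_vec \<gamma>) (t *\<^sub>R v) < e" "dist (real_vec \<gamma>) (t *\<^sub>R v) < 1"
    using t(2) by auto
  have "t *\<^sub>R v \<in> \<theta>"
    using v by (simp add: span_base span_scale)
  moreover have "2 * b \<le> \<bar>\<gamma> $ j\<bar>"
  proof -
    have "2 * real_of_int b + 1 \<le> t * \<bar>v $ j\<bar>"
      using t1 j by (simp add: field_simps)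
    moreover have "\<bar>real_of_int (\<gamma> $ j) - t * v $ j\<bar> < 1"
      using component_le_norm_cart[of "real_vec \<gamma> - t *\<^sub>R v" j] near(2)
      by (simp add: dist_norm real_vec_def)
    moreover have "\<bar>t * v $ j\<bar> = t * \<bar>v $ j\<bar>"
      using \<open>1 \<le> t\<close> by (simp add: abs_mult)
    ultimately have "2 * real_of_int b \<le> real_of_int \<bar>\<gamma> $ j\<bar>"
      by linarith
    then show ?thesis
      by linarith
  qed
  moreover have "real_of_int b + 1 \<le> dist (real_vec \<gamma>) g" if \<eta>: "\<eta> \<in> projective_space - U" "g \<in> \<eta>" for \<eta> g
  proof (rule ccontr)
    let ?h = "inverse t *\<^sub>R g"
    assume "\<not> ?thesis"
    then have "dist (t *\<^sub>R v) g < real_of_int b + 2"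
      using near(2) dist_triangle3[of "t *\<^sub>R v" g "real_vec \<gamma>"] by linarith
    moreover have "dist (t *\<^sub>R v) g = t * dist v ?h"
    proof -
      have "t *\<^sub>R v - g = t *\<^sub>R (v - ?h)"
        using \<open>1 \<le> t\<close> by (simp add: scaleR_right_diff_distrib)
      then show ?thesis
        using \<open>1 \<le> t\<close> by (simp add: dist_norm)
    qed
    ultimately have "dist v ?h < (real_of_int b + 2) / t"
      using \<open>1 \<le> t\<close> by (simp add: field_simps)
    also have "\<dots> \<le> \<delta>"
      using t2 \<delta>(1) \<open>1 \<le> t\<close> by (simp add: field_simps)
    finally have h: "?h \<noteq> 0" "span {?h} \<in> U"
      using \<delta>(2) by (auto simp: subset_iff)
    moreover have "?h \<in> \<eta>"
      using \<eta> by (auto simp: projective_space_def subspace_scale)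
    ultimately show False
      using \<eta> span_eq_projective_line[of \<eta> ?h] by auto
  qed
  ultimately show ?thesis
    using near(1) by blast
qed

section \<open>Realizing recurrence lines\<close>

text \<open>The first component of the pairing takes every value infinitely often, so each member of
  \<open>D\<close> recurs, whether \<open>D\<close> is finite or infinite.\<close>

lemma frequently_from_nat_into:
  assumes "countable D" "\<theta> \<in> D"
  shows "\<exists>\<^sub>F n in sequentially. from_nat_into D (fst (prod_decode n)) = \<theta>"
  unfolding frequently_sequentially
proof
  fix N
  obtain k where "from_nat_into D k = \<theta>"
    using from_nat_into_surj[OF assms] by blast
  then have "from_nat_into D (fst (prod_decode (prod_encode (k, N)))) = \<theta>"
    by simp
  then show "\<exists>n\<ge>N. from_nat_into D (fst (prod_decode n)) = \<theta>"
    using le_prod_encode_2 by blast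
qed

lemma action_with_recurrence_between:
  fixes D :: "(real ^ 'd) set set"
  assumes "CARD('d) \<ge> 2" and "gdelta_in projective_topology \<Delta>" and D: "countable D" "D \<subseteq> \<Delta>" "D \<noteq> {}"
  shows "\<exists>T :: int ^ 'd \<Rightarrow> real \<Rightarrow> real. lattice_action half_line T \<and> free_action half_line T \<and>
    rank_one half_line T \<and> D \<subseteq> recurrence_lines half_line T \<and> recurrence_lines half_line T \<subseteq> \<Delta>"
proof -
  obtain U where U: "\<And>n. openin projective_topology (U n)" "\<And>n. U (Suc n) \<subseteq> U n" "\<Inter> (range U) = \<Delta>"
    using assms(2) unfolding gdelta_in_descending by blast
  define \<theta> where "\<theta> n = from_nat_into D (fst (prod_decode n))" for n
  have \<theta>: "\<theta> n \<in> U n" for n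
    using from_nat_into[OF D(3)] D(2) U(3) by (auto simp: \<theta>_def)
  \<comment> \<open>The choice is made for every \<open>b\<close>, since the actual size
    \<open>a n\<close> is only fixed by the later recursion. The tolerance tends to 0, as recurrence
    requires.\<close>
  have "\<exists>\<gamma>. (\<exists>g\<in>\<theta> n. dist (real_vec \<gamma>) g < 1 / real (Suc n)) \<and> (\<exists>j. 2 * b \<le> \<bar>\<gamma> $ j\<bar>) \<and>
    (\<forall>\<eta>\<in>projective_space - U n. \<forall>g\<in>\<eta>. real_of_int b + 1 \<le> dist (real_vec \<gamma>) g)" for n b
    using U(1) \<theta> by (rule lattice_point_avoiding) simp
  then obtain pick where near: "\<And>n b. \<exists>g\<in>\<theta> n. dist (real_vec (pick n b)) g < 1 / real (Suc n)"
    and large: "\<And>n b. \<exists>j. 2 * b \<le> \<bar>pick n b $ j\<bar>"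
    and far: "\<And>n b \<eta> g. \<eta> \<in> projective_space - U n \<Longrightarrow> g \<in> \<eta> \<Longrightarrow>
      real_of_int b + 1 \<le> dist (real_vec (pick n b)) g"
    by metis
  obtain a p where "dyadic_towers a (\<lambda>n. pick n (a n)) p"
    using towers_of_choice[where pick = pick, OF assms(1) large] by blast
  then interpret dyadic_towers a "\<lambda>n. pick n (a n)" p .
  have "recurrent_along half_line shift \<eta>" if "\<eta> \<in> D" for \<eta>
  proof (rule recurrent_along_shift)
    fix e :: real assume "0 < e"
    have "(\<lambda>n. 1 / real (Suc n)) \<longlonglongrightarrow> 0"
      by (rule lim_const_over_n[THEN LIMSEQ_Suc])
    then have "\<forall>\<^sub>F n in sequentially. 1 / real (Suc n) < e"
      using \<open>0 < e\<close> by (rule order_tendstoD)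
    with frequently_from_nat_into[OF D(1) that]
    have "\<exists>\<^sub>F n in sequentially. 1 / real (Suc n) < e \<and> \<theta> n = \<eta>"
      unfolding \<theta>_def by (rule frequently_eventually_conj)
    then show "\<exists>\<^sub>F n in sequentially. \<exists>g\<in>\<eta>. dist (real_vec (pick n (a n))) g < e"
    proof (rule frequently_elim1)
      fix n assume n: "1 / real (Suc n) < e \<and> \<theta> n = \<eta>"
      obtain g where "g \<in> \<theta> n" "dist (real_vec (pick n (a n))) g < 1 / real (Suc n)"
        using near by blast
      then show "\<exists>g\<in>\<eta>. dist (real_vec (pick n (a n))) g < e"
        using n by (intro bexI[of _ g]) auto
    qed
  qed
  then have "D \<subseteq> recurrence_lines half_line shift"
    using D(2) gdelta_in_subset[OF assms(2)]
    by (auto simp: recurrence_lines_def topspace_projective_topology)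
  moreover have "\<not> recurrent_along half_line shift \<eta>" if \<eta>: "\<eta> \<in> projective_space" "\<eta> \<notin> \<Delta>" for \<eta>
  proof (rule not_recurrent_along_shift)
    show "subspace \<eta>"
      using \<eta>(1) by (simp add: projective_space_def)
    obtain m where m: "\<eta> \<notin> U m"
      using \<eta>(2) U(3) by blast
    \<comment> \<open>As the \<open>U n\<close> decrease, a line missing one of them misses all
      later ones, and \<open>far\<close> applies from there on.\<close>
    have "\<eta> \<notin> U n" if "m \<le> n" for n
      using that m lift_Suc_antimono_le[of U] U(2) by blast
    then show "\<forall>\<^sub>F n in sequentially. \<forall>g\<in>\<eta>. real_of_int (a n) + 1 \<le> dist (real_vec (pick n (a n))) g"
      using far \<eta>(1) unfolding eventually_sequentially by blast
  qed
  then have "recurrence_lines half_line shift \<subseteq> \<Delta>"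
    by (auto simp: recurrence_lines_def)
  ultimately show ?thesis
    using lattice_action_shift free_action_shift rank_one_shift by blast
qed

text \<open>
  On the parabola \<open>(N\<^sup>2, N, 0, \<dots>)\<close> the points leave every line, at a rate proportional to \<open>N\<^sup>2\<close>
  except for the first coordinate axis, where the rate is \<open>N\<close>.
\<close>

lemma action_without_recurrence:
  assumes "CARD('d) \<ge> 2"
  shows "\<exists>T :: int ^ 'd \<Rightarrow> real \<Rightarrow> real. lattice_action half_line T \<and> free_action half_line T \<and>
    rank_one half_line T \<and> recurrence_lines half_line T = {}"
proof -
  obtain i k :: 'd where ik: "i \<noteq> k"
    using assms card_le_Suc0_iff_eq[of "UNIV :: 'd set"] by auto
  define pick :: "nat \<Rightarrow> int \<Rightarrow> int ^ 'd"
    where "pick n b = (\<chi> j. if j = i then (b + 1)\<^sup>2 else if j = k then b + 1 else 0)" for n b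
  have large: "\<exists>j. 2 * b \<le> \<bar>pick n b $ j\<bar>" for n b
  proof -
    have "2 * b \<le> (b + 1)\<^sup>2"
      by (simp add: power2_sum)
    then show ?thesis
      by (intro exI[of _ i]) (simp add: pick_def)
  qed
  obtain a p where "dyadic_towers a (\<lambda>n. pick n (a n)) p"
    using towers_of_choice[where pick = pick, OF assms large] by blast
  then interpret dyadic_towers a "\<lambda>n. pick n (a n)" p .
  have "\<not> recurrent_along half_line shift \<eta>" if \<eta>: "\<eta> \<in> projective_space" for \<eta>
  proof (rule not_recurrent_along_shift)
    show "subspace \<eta>"
      using \<eta> by (simp add: projective_space_def)
    obtain w where w: "w \<noteq> 0" "\<eta> = span {w}"
      using \<eta> by (rule projective_line_spanned)
    \<comment> \<open>The sum bounds the constants for all \<open>j\<close> at once; terms with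
      \<open>w $ j = 0\<close> vanish, division by zero being 0.\<close>
    define R where "R = 1 + (\<Sum>j\<in>UNIV. 2 * \<bar>w $ i\<bar> / \<bar>w $ j\<bar>)"
    have R: "1 + 2 * \<bar>w $ i\<bar> / \<bar>w $ j\<bar> \<le> R" for j
      unfolding R_def
      by (intro add_left_mono member_le_sum[of j UNIV "\<lambda>j. 2 * \<bar>w $ i\<bar> / \<bar>w $ j\<bar>"]) auto
    have "real_of_int b + 1 \<le> dist (real_vec (pick n b)) (s *\<^sub>R w)"
      if b: "R \<le> real_of_int b" "0 < b" for s b n
    proof (rule ccontr)
      define N where "N = real_of_int b + 1"
      have N: "0 < N" "R < N"
        using b by (auto simp: N_def)
      assume "\<not> ?thesis"
      then have *: "\<bar>real_of_int (pick n b $ j) - s * w $ j\<bar> < N" for j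
        using component_le_norm_cart[of "real_vec (pick n b) - s *\<^sub>R w" j]
        by (simp add: dist_norm real_vec_def N_def)
      have i: "\<bar>N\<^sup>2 - s * w $ i\<bar> < N"
        using *[of i] by (simp add: pick_def N_def)
      show False
      proof (cases "\<forall>j. j \<noteq> i \<longrightarrow> w $ j = 0")
        case True
        then show False
          using *[of k] ik N by (simp add: pick_def N_def)
      next
        case False
        then obtain j where j: "j \<noteq> i" "w $ j \<noteq> 0"
          by blast
        \<comment> \<open>Coordinate \<open>j\<close> forces \<open>s\<close> to be of order
          \<open>N\<close>, which is too small for \<open>s * w $ i\<close> to approach
          \<open>N\<^sup>2\<close>.\<close>
        have "\<bar>real_of_int (pick n b $ j)\<bar> \<le> N"
          using j(1) N by (simp add: pick_def N_def)
        then have "\<bar>s * w $ j\<bar> < 2 * N"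
          using *[of j] by linarith
        then have "\<bar>s\<bar> < 2 * N / \<bar>w $ j\<bar>"
          using j(2) by (simp add: abs_mult field_simps)
        then have "\<bar>s\<bar> * \<bar>w $ i\<bar> \<le> 2 * N / \<bar>w $ j\<bar> * \<bar>w $ i\<bar>"
          by (intro mult_right_mono) auto
        then have "N\<^sup>2 < N + 2 * N / \<bar>w $ j\<bar> * \<bar>w $ i\<bar>"
          using i by (simp add: abs_mult[symmetric])
        also have "\<dots> = N * (1 + 2 * \<bar>w $ i\<bar> / \<bar>w $ j\<bar>)"
          by (simp add: algebra_simps)
        also have "\<dots> \<le> N * N"
          using R[of j] N by (intro mult_left_mono) auto
        finally show False
          by (simp add: power2_eq_square)
      qed
    qed
    moreover have "\<forall>\<^sub>F n in sequentially. \<lceil>R\<rceil> \<le> a n"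
      using filterlim_a by (simp add: filterlim_at_top)
    then have "\<forall>\<^sub>F n in sequentially. R \<le> real_of_int (a n)"
      by eventually_elim (simp add: ceiling_le_iff)
    ultimately show "\<forall>\<^sub>F n in sequentially. \<forall>g\<in>\<eta>.
        real_of_int (a n) + 1 \<le> dist (real_vec (pick n (a n))) g"
      using a_pos w(2) by (auto elim!: eventually_mono simp: span_singleton)
  qed
  then have "recurrence_lines half_line shift = {}"
    by (auto simp: recurrence_lines_def)
  then show ?thesis
    using lattice_action_shift free_action_shift rank_one_shift by blast
qed

section \<open>Compact sets of lines\<close>

text \<open>On nonzero vectors it depends only on the lines they span, and it is 1 only for equal
  lines. It serves in place of a metric on projective space.\<close>

definition abs_cosine :: "'v::real_inner \<Rightarrow> 'v \<Rightarrow> real"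
  where "abs_cosine x y = \<bar>x \<bullet> y\<bar> / (norm x * norm y)"

lemma abs_cosine_span:
  assumes "x' \<in> span {x}" "x' \<noteq> 0"
  shows "abs_cosine x' y = abs_cosine x y"
  using assms by (auto simp: span_singleton abs_cosine_def abs_mult)

lemma abs_cosine_commute: "abs_cosine x y = abs_cosine y x"
  by (simp add: abs_cosine_def inner_commute mult.commute)

text \<open>Equality in the Cauchy-Schwarz inequality would make \<open>x\<close> and
  \<open>y\<close> proportional.\<close>

lemma abs_cosine_less_1:
  fixes x y :: "real ^ 'd"
  assumes "x \<noteq> 0" "y \<noteq> 0" "span {x} \<noteq> span {y}"
  shows "abs_cosine x y < 1"
proof -
  have "\<bar>x \<bullet> y\<bar> \<noteq> norm x * norm y"
  proof
    assume "\<bar>x \<bullet> y\<bar> = norm x * norm y"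
    then have "norm x *\<^sub>R y = norm y *\<^sub>R x \<or> norm x *\<^sub>R y = - norm y *\<^sub>R x"
      by (simp add: norm_cauchy_schwarz_abs_eq)
    then obtain r where "norm x *\<^sub>R y = r *\<^sub>R x"
      by blast
    then have "y = (r / norm x) *\<^sub>R x"
      using assms(1) eq_vector_fraction_iff[of y r "norm x" x] by simp
    then have "y \<in> span {x}"
      by (metis insertI1 span_base span_scale)
    then show False
      using assms span_eq_projective_line[of "span {x}" y] span_singleton_in_projective_space[of x]
      by auto
  qed
  then show ?thesis
    using Cauchy_Schwarz_ineq2[of x y] assms by (simp add: abs_cosine_def)
qed

lemma openin_abs_cosine:
  fixes y :: "real ^ 'd"
  assumes "open T"
  shows "openin projective_topology {\<theta> \<in> projective_space. \<exists>x\<in>\<theta>. x \<noteq> 0 \<and> abs_cosine x y \<in> T}"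
proof -
  have "{x. x \<noteq> 0 \<and> span {x} \<in> {\<theta> \<in> projective_space. \<exists>x\<in>\<theta>. x \<noteq> 0 \<and> abs_cosine x y \<in> T}} =
      (- {0}) \<inter> (\<lambda>x. abs_cosine x y) -` T"
    using span_singleton_in_projective_space abs_cosine_span span_base by fastforce
  moreover have "open ((- {0}) \<inter> (\<lambda>x. abs_cosine x y) -` T)"
  proof (cases "y = 0")
    case True
    then show ?thesis
      by (cases "0 \<in> T") (simp_all add: abs_cosine_def vimage_def open_Compl)
  next
    case False
    then show ?thesis
      using assms unfolding abs_cosine_def
      by (intro continuous_open_preimage continuous_intros) auto
  qed
  ultimately show ?thesis
    by (simp add: openin_projective_topology Collect_conj_eq)
qed

text \<open>\<open>K\<close> is the intersection of its open neighbourhoods \<open>near n\<close>.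
  For a line outside \<open>K\<close>, the cosines with lines of \<open>K\<close> are below 1, and
  compactness bounds them by a single \<open>r m\<close>, so \<open>near m\<close> misses that
  line.\<close>

lemma compactin_projective_imp_gdelta_in:
  assumes "compactin projective_topology K"
  shows "gdelta_in projective_topology K"
proof -
  have K: "K \<subseteq> projective_space"
    using compactin_subset_topspace[OF assms] by (simp add: topspace_projective_topology)
  define r where "r n = 1 - 1 / real (Suc n)" for n
  have r_mono: "r m \<le> r n" if "m \<le> n" for m n
    using that by (simp add: r_def frac_le)
  define near where "near n = (\<Union>y\<in>{y. y \<noteq> 0 \<and> span {y} \<in> K}.
    {\<theta> \<in> projective_space. \<exists>x\<in>\<theta>. x \<noteq> 0 \<and> abs_cosine x y \<in> {r n<..}})" for n
  have "openin projective_topology (near n)" for n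
    unfolding near_def by (intro openin_Union) (auto simp del: greaterThan_iff intro!: openin_abs_cosine)
  then have "gdelta_in projective_topology (\<Inter> (range near))"
    by (intro gdelta_in_Inter) (auto intro: open_imp_gdelta_in)
  moreover have "K \<subseteq> near n" for n
  proof
    fix \<theta> assume "\<theta> \<in> K"
    moreover from this K obtain y where "y \<noteq> 0" "\<theta> = span {y}"
      using projective_line_spanned by blast
    moreover from this have "abs_cosine y y = 1" "y \<in> \<theta>"
      by (auto simp: abs_cosine_def span_base dot_square_norm power2_eq_square)
    moreover have "r n < 1"
      by (simp add: r_def)
    ultimately show "\<theta> \<in> near n"
      using K by (fastforce simp: near_def)
  qed
  moreover have "\<theta> \<in> K" if "\<theta> \<in> \<Inter> (range near)" for \<theta>
  proof (rule ccontr)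
    assume "\<theta> \<notin> K"
    have "\<theta> \<in> projective_space"
      using that by (auto simp: near_def)
    then obtain x where x: "x \<noteq> 0" "\<theta> = span {x}"
      by (rule projective_line_spanned)
    let ?V = "\<lambda>n. {\<eta> \<in> projective_space. \<exists>y\<in>\<eta>. y \<noteq> 0 \<and> abs_cosine y x \<in> {..<r n}}"
    have "K \<subseteq> \<Union> (range ?V)"
    proof
      fix \<eta> assume "\<eta> \<in> K"
      moreover from this K obtain y where y: "y \<noteq> 0" "\<eta> = span {y}"
        using projective_line_spanned by blast
      ultimately have "abs_cosine y x < 1"
        using x \<open>\<theta> \<notin> K\<close> by (intro abs_cosine_less_1) auto
      moreover have "r \<longlonglongrightarrow> 1 - 0"
        unfolding r_def by (intro tendsto_intros lim_const_over_n[THEN LIMSEQ_Suc])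
      ultimately have "\<forall>\<^sub>F n in sequentially. abs_cosine y x < r n"
        by (intro order_tendstoD(1)[of r]) auto
      then obtain n where "abs_cosine y x < r n"
        using eventually_happens trivial_limit_sequentially by blast
      then show "\<eta> \<in> \<Union> (range ?V)"
        using y \<open>\<eta> \<in> K\<close> K span_base by blast
    qed
    moreover have "openin projective_topology (?V n)" for n
      by (rule openin_abs_cosine) simp
    then have "\<forall>W\<in>range ?V. openin projective_topology W"
      by blast
    ultimately obtain \<F> where \<F>: "finite \<F>" "\<F> \<subseteq> range ?V" "K \<subseteq> \<Union> \<F>"
      using assms unfolding compactin_def by meson
    obtain I where I: "finite I" "K \<subseteq> \<Union> (?V ` I)"
      using finite_subset_image[OF \<F>(1,2)] \<F>(3) by blast
    obtain m where m: "\<And>n. n \<in> I \<Longrightarrow> n \<le> m"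
      using finite_nat_set_iff_bounded_le[of I] I(1) by blast
    have "\<theta> \<in> near m"
      using that by blast
    then obtain y x' where y: "y \<noteq> 0" "span {y} \<in> K" "x' \<in> \<theta>" "x' \<noteq> 0" "r m < abs_cosine x' y"
      by (auto simp: near_def)
    obtain n y' where n: "n \<in> I" "y' \<in> span {y}" "y' \<noteq> 0" "abs_cosine y' x < r n"
      using I(2) y(2) by auto
    \<comment> \<open>Both are the cosine of the same two lines, yet one exceeds \<open>r m\<close>
      and the other is below \<open>r n \<le> r m\<close>.\<close>
    have "abs_cosine x' y = abs_cosine y' x"
      using x y n by (metis abs_cosine_commute abs_cosine_span)
    then show False
      using y n r_mono[OF m[OF n(1)]] by simp
  qed
  ultimately show ?thesis
    by (metis (no_types, lifting) INT_greatest subsetI subset_antisym)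
qed

theorem theorem4p2:
  assumes "CARD('d::finite) \<ge> 2"
  shows
    "(\<forall>\<Delta> D :: (real ^ 'd) set set.
        gdelta_in projective_topology \<Delta> \<and> countable D \<and> D \<subseteq> \<Delta> \<longrightarrow>
        (\<exists>(M :: real measure) (T :: int ^ 'd \<Rightarrow> real \<Rightarrow> real).
           lattice_action M T \<and> emeasure M (space M) = \<infinity> \<and> free_action M T \<and> rank_one M T \<and>
           D \<subseteq> recurrence_lines M T \<and> recurrence_lines M T \<subseteq> \<Delta>)) \<and>
     (\<forall>\<Delta> :: (real ^ 'd) set set.
        countable \<Delta> \<and> (gdelta_in projective_topology \<Delta> \<or> compactin projective_topology \<Delta>) \<longrightarrow>
        (\<exists>(M :: real measure) (T :: int ^ 'd \<Rightarrow> real \<Rightarrow> real).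
           lattice_action M T \<and> free_action M T \<and> rank_one M T \<and>
           recurrence_lines M T = \<Delta>))"
proof -
  have *: "\<exists>T :: int ^ 'd \<Rightarrow> real \<Rightarrow> real. lattice_action half_line T \<and> free_action half_line T \<and>
      rank_one half_line T \<and> D \<subseteq> recurrence_lines half_line T \<and> recurrence_lines half_line T \<subseteq> \<Delta>"
    if "gdelta_in projective_topology \<Delta>" "countable D" "D \<subseteq> \<Delta>" for \<Delta> D :: "(real ^ 'd) set set"
    \<comment> \<open>For empty \<open>D\<close> no sequence through \<open>D\<close> exists; an
      action without any line of recurrence suits every \<open>\<Delta>\<close>.\<close>
    using action_with_recurrence_between[OF assms that] action_without_recurrence[OF assms]
    by (cases "D = {}") auto
  show ?thesis
  proof (intro conjI allI impI)
    fix \<Delta> D :: "(real ^ 'd) set set"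
    assume "gdelta_in projective_topology \<Delta> \<and> countable D \<and> D \<subseteq> \<Delta>"
    then show "\<exists>(M :: real measure) (T :: int ^ 'd \<Rightarrow> real \<Rightarrow> real).
        lattice_action M T \<and> emeasure M (space M) = \<infinity> \<and> free_action M T \<and> rank_one M T \<and>
        D \<subseteq> recurrence_lines M T \<and> recurrence_lines M T \<subseteq> \<Delta>"
      using *[of \<Delta> D] emeasure_half_line_space by blast
  next
    fix \<Delta> :: "(real ^ 'd) set set"
    assume "countable \<Delta> \<and> (gdelta_in projective_topology \<Delta> \<or> compactin projective_topology \<Delta>)"
    then show "\<exists>(M :: real measure) (T :: int ^ 'd \<Rightarrow> real \<Rightarrow> real).
        lattice_action M T \<and> free_action M T \<and> rank_one M T \<and> recurrence_lines M T = \<Delta>"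
      using *[of \<Delta> \<Delta>] compactin_projective_imp_gdelta_in by blast
  qed
qed

end
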